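(* Consider the sparsity mechanism in which each client uploads to the server the first $m$ of $n$ coordinates of its parameter: for every $k\in[K]$, $P_k^{\mathcal O}=\mathcal N(\mu_0,\Sigma_0)$ with $\mu_0=(\mu_u,\mu_o)$, $\mu_u\in\mathbb R^m$, $\mu_o\in\mathbb R^{n-m}$, $\Sigma_0=\mathrm{diag}(\Sigma_u,\Sigma_o)$ a diagonal covariance matrix ($\Sigma_u$ of size $m\times m$, $\Sigma_o$ of size $(n-m)\times(n-m)$); the last $n-m$ coordinates of the protected information follow $\mathcal N(\mu_g,\Sigma_g)$ with $\Sigma_g$ a diagonal $(n-m)\times(n-m)$ covariance matrix, so that $P_k^{\mathcal S}=\mathcal N(\mu,\Sigma)$ with $\mu=(\mu_u,\mu_g)$, $\Sigma=\mathrm{diag}(\Sigma_u,\Sigma_g)$. The aggregated (averaged) parameters have distributions $P_a^{\mathcal O}=\mathcal N(\mu_0,\Sigma_0/K)$ and $P_a^{\mathcal S}=\mathcal N(\mu,\Sigma/K)$. Denote $$h(\mu_1,\Sigma_1,\mu_2,\Sigma_2)=\left(1-\frac{\det(\Sigma_1)^{1/4}\det(\Sigma_2)^{1/4}}{\det\left(\frac{\Sigma_1+\Sigma_2}2\right)^{1/2}}\exp\Big\{-\tfrac18(\mu_1-\mu_2)^T\big(\tfrac{\Sigma_1+\Sigma_2}2\big)^{-1}(\mu_1-\mu_2)\Big\}\right)^{1/2}.$$ Then $$C_1\le\epsilon_p+C_3\,h(\mu_o,\Sigma_o,\mu_g,\Sigma_g)\quad\text{and}\quad\epsilon_u\le C\,h(\mu_o,\Sigma_o,\mu_g,\Sigma_g),$$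 where $C_1=\frac1K\sum_{k=1}^K\sqrt{\mathrm{JS}(F_k^{\mathcal O}\|F_k^{\mathcal B})}$ and $C_3=\frac{\sqrt2(e^{2\xi}-1)}2$ are two constants independent of the protection mechanisms adopted, and $C$ is a constant satisfying $\sqrt2\,U(w,d)\le C$ for any $w\in\mathcal W_k$ and $d\in\mathcal D_k$.
   Context: There are $K$ clients. For $k\in[K]=\{1,\dots,K\}$, $D_k$ is client $k$'s private data, a random variable with support $\mathcal D_k$; $P_k^{\mathcal O}$ and $P_k^{\mathcal S}$ are the distributions (on $\mathbb R^n$) of the unprotected and protected model information of client $k$; $\mathcal W_k$ is the union of their supports. $P_a^{\mathcal O}$, $P_a^{\mathcal S}$ are the distributions of the unprotected and protected aggregated model information. Adversary's beliefs: $f_{D_k}$ is a prior density on $\mathcal D_k$ (with respect to a fixed reference measure) and, for $w\in\mathcal W_k$, $f_{D_k|W_k}(\cdot|w)$ is the posterior density given $w$. $F^{\mathcal A}_k$, $F^{\mathcal O}_k$, $F^{\mathcal B}_k$ are the distributions on $\mathcal D_k$ with densities $f^{\mathcal A}_{D_k}(d)=\int_{\mathcal W_k}f_{D_k|W_k}(d|w)\,dP_k^{\mathcal S}(w)$, $f^{\mathcal O}_{D_k}(d)=\int_{\mathcal W_k}f_{D_k|W_k}(d|w)\,dP_k^{\mathcal O}(w)$, $f^{\mathcal B}_{D_k}(d)=f_{D_k}(d)$. $\mathrm{JS}(P\|Q)=\frac12[\mathrm{KL}(P\|M)+\mathrm{KL}(Q\|M)]$ with $M=(P+Q)/2$, where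 $\mathrm{KL}(P\|Q)=\int p\log(p/q)$. Privacy leakage: $\epsilon_{p,k}=\sqrt{\mathrm{JS}(F_k^{\mathcal A}\|F_k^{\mathcal B})}$ and $\epsilon_p=\frac1K\sum_{k=1}^K\epsilon_{p,k}$. $\xi=\max_{k\in[K]}\max_{w\in\mathcal W_k,\,d\in\mathcal D_k}\left|\log\frac{f_{D_k|W_k}(d|w)}{f_{D_k}(d)}\right|$. Utility: $U(w,d)$ is the utility of model $w$ on data point $d$; $U_k(w)=\mathbb E_{D_k}\frac1{|D_k|}\sum_{d\in D_k}U(w,d)$ and $U_k(P)=\mathbb E_{w\sim P}U_k(w)$. Utility loss: $\epsilon_u=\frac1K\sum_{k=1}^K[U_k(P_a^{\mathcal O})-U_k(P_a^{\mathcal S})]$.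
   Formalization: The utility bound is false for some C with √2U≤C if K≥2 or U<0; proved for U≥0: some such C, independent of means and covariances, has ε_u≤C·h, and every such C has ε_u≤C·h(μ_o,Σ_o/K,μ_g,Σ_g/K). Variances are taken positive. *)

theory Defs
  imports "HOL-Probability.Probability"
begin

section \<open>Block vectors, block matrices and Gaussian distributions\<close>

text \<open>
  A vector of \<open>\<real>\<^sup>n\<close> with \<open>n = m + (n - m)\<close> has index type \<^typ>\<open>'m + 'o\<close>: the summand
  \<^typ>\<open>'m\<close> indexes the first \<open>m\<close> coordinates, \<^typ>\<open>'o\<close> the last \<open>n - m\<close>.
\<close>

definition vec_append :: "real ^ 'm \<Rightarrow> real ^ 'o \<Rightarrow> real ^ ('m::finite + 'o::finite)" where
  "vec_append u v = (\<chi> i. case i of Inl a \<Rightarrow> u $ a | Inr b \<Rightarrow> v $ b)"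

definition block_diag ::
    "real ^ 'm ^ 'm \<Rightarrow> real ^ 'o ^ 'o \<Rightarrow> real ^ ('m::finite + 'o::finite) ^ ('m + 'o)" where
  "block_diag A B = (\<chi> i j. case i of
      Inl a \<Rightarrow> (case j of Inl a' \<Rightarrow> A $ a $ a' | Inr b' \<Rightarrow> 0)
    | Inr b \<Rightarrow> (case j of Inl a' \<Rightarrow> 0 | Inr b' \<Rightarrow> B $ b $ b'))"

text \<open>
  Variances are strictly positive, so that the Gaussians have densities and the inverse
  in the formula for \<open>h\<close> exists.
\<close>

definition diagonal_covariance :: "real ^ 'n ^ 'n \<Rightarrow> bool" where
  "diagonal_covariance S \<longleftrightarrow> (\<forall>i j. i \<noteq> j \<longrightarrow> S $ i $ j = 0) \<and> (\<forall>i. 0 < S $ i $ i)"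

definition mv_normal :: "real ^ 'n \<Rightarrow> real ^ 'n ^ 'n \<Rightarrow> (real ^ 'n) measure" where
  "mv_normal \<mu> S = density lborel (\<lambda>x. ennreal
     (exp (- (1/2) * ((x - \<mu>) \<bullet> (matrix_inv S *v (x - \<mu>)))) /
      sqrt ((2 * pi) ^ CARD('n) * det S)))"

definition h_dist ::
    "real ^ 'n \<Rightarrow> real ^ 'n ^ 'n \<Rightarrow> real ^ 'n \<Rightarrow> real ^ 'n ^ 'n \<Rightarrow> real" where
  "h_dist \<mu>1 S1 \<mu>2 S2 =
     (let M = (1/2) *\<^sub>R (S1 + S2) in
      sqrt (1 - det S1 powr (1/4) * det S2 powr (1/4) / det M powr (1/2) *
                exp (- (1/8) * ((\<mu>1 - \<mu>2) \<bullet> (matrix_inv M *v (\<mu>1 - \<mu>2))))))"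

definition measure_support :: "'a::topological_space measure \<Rightarrow> 'a set" where
  "measure_support M = {x. \<forall>S. open S \<and> x \<in> S \<longrightarrow> 0 < emeasure M S}"

definition model_space ::
    "(nat \<Rightarrow> 'w::topological_space measure) \<Rightarrow> (nat \<Rightarrow> 'w measure) \<Rightarrow> nat \<Rightarrow> 'w set" where
  "model_space PO PS k = measure_support (PO k) \<union> measure_support (PS k)"


section \<open>Jensen--Shannon divergence\<close>

definition mixture :: "'a measure \<Rightarrow> 'a measure \<Rightarrow> 'a measure" where
  "mixture P Q = measure_of (space P) (sets P) (\<lambda>A. (emeasure P A + emeasure Q A) / 2)"

text \<open>
  The library's \<^term>\<open>KL_divergence b M N\<close> is the divergence of \<open>N\<close> from \<open>M\<close>,
  i.e. \<open>KL(N \<parallel> M)\<close>, with logarithms to base \<open>b\<close>.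
\<close>

definition JS_divergence :: "'a measure \<Rightarrow> 'a measure \<Rightarrow> real" where
  "JS_divergence P Q =
     (KL_divergence (exp 1) (mixture P Q) P + KL_divergence (exp 1) (mixture P Q) Q) / 2"


section \<open>Beliefs of the adversary and privacy leakage\<close>

text \<open>
  \<open>\<nu> k\<close> is the reference measure for client \<open>k\<close>; the set \<open>\<D>\<^sub>k\<close> is \<^term>\<open>space (\<nu> k)\<close>.
  \<^term>\<open>prior k d\<close> stands for \<open>f\<^bsub>D_k\<^esub>(d)\<close> and \<^term>\<open>post k d w\<close> for \<open>f\<^bsub>D_k|W_k\<^esub>(d|w)\<close>.
  Positivity of both densities and boundedness of the log-ratios say that the maximum
  \<open>\<xi>\<close> is a real number.
\<close>

definition log_ratios ::
    "nat \<Rightarrow> (nat \<Rightarrow> 'd measure) \<Rightarrow> (nat \<Rightarrow> 'w set) \<Rightarrow> (nat \<Rightarrow> 'd \<Rightarrow> real) \<Rightarrow>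
     (nat \<Rightarrow> 'd \<Rightarrow> 'w \<Rightarrow> real) \<Rightarrow> real set" where
  "log_ratios K \<nu> W prior post =
     {\<bar>ln (post k d w / prior k d)\<bar> | k w d. k \<in> {1..K} \<and> w \<in> W k \<and> d \<in> space (\<nu> k)}"

definition adversary_beliefs ::
    "nat \<Rightarrow> (nat \<Rightarrow> 'd measure) \<Rightarrow> (nat \<Rightarrow> 'w::topological_space set) \<Rightarrow>
     (nat \<Rightarrow> 'd \<Rightarrow> real) \<Rightarrow> (nat \<Rightarrow> 'd \<Rightarrow> 'w \<Rightarrow> real) \<Rightarrow> bool" where
  "adversary_beliefs K \<nu> W prior post \<longleftrightarrow>
     (\<forall>k\<in>{1..K}.
        sigma_finite_measure (\<nu> k) \<and>
        prior k \<in> borel_measurable (\<nu> k) \<and>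
        (\<forall>d\<in>space (\<nu> k). 0 < prior k d) \<and>
        (\<integral>\<^sup>+ d. ennreal (prior k d) \<partial>\<nu> k) = 1 \<and>
        (\<lambda>(d, w). post k d w) \<in> borel_measurable (\<nu> k \<Otimes>\<^sub>M restrict_space borel (W k)) \<and>
        (\<forall>w\<in>W k. (\<forall>d\<in>space (\<nu> k). 0 < post k d w) \<and>
                   (\<integral>\<^sup>+ d. ennreal (post k d w) \<partial>\<nu> k) = 1)) \<and>
     bdd_above (log_ratios K \<nu> W prior post)"

definition xi ::
    "nat \<Rightarrow> (nat \<Rightarrow> 'd measure) \<Rightarrow> (nat \<Rightarrow> 'w set) \<Rightarrow> (nat \<Rightarrow> 'd \<Rightarrow> real) \<Rightarrow>
     (nat \<Rightarrow> 'd \<Rightarrow> 'w \<Rightarrow> real) \<Rightarrow> real" where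
  "xi K \<nu> W prior post = Sup (log_ratios K \<nu> W prior post)"

definition prior_belief :: "'d measure \<Rightarrow> ('d \<Rightarrow> real) \<Rightarrow> 'd measure" where
  "prior_belief \<nu> f = density \<nu> (\<lambda>d. ennreal (f d))"

text \<open>
  \<open>F\<^sup>\<A>\<close> and \<open>F\<^sup>\<O>\<close> are the instances with \<open>P\<close> the protected, respectively the
  unprotected, distribution.
\<close>

definition posterior_belief ::
    "'d measure \<Rightarrow> ('d \<Rightarrow> 'w \<Rightarrow> real) \<Rightarrow> 'w set \<Rightarrow> 'w measure \<Rightarrow> 'd measure" where
  "posterior_belief \<nu> f W P = density \<nu> (\<lambda>d. ennreal (LINT w:W|P. f d w))"

text \<open>
  With \<open>P = P\<^sup>\<S>\<close> this is the privacy leakage \<open>\<epsilon>\<^sub>p\<close>; with \<open>P = P\<^sup>\<O>\<close> it is the constant \<open>C\<^sub>1\<close>.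
\<close>

definition avg_leakage ::
    "nat \<Rightarrow> (nat \<Rightarrow> 'd measure) \<Rightarrow> (nat \<Rightarrow> 'w set) \<Rightarrow> (nat \<Rightarrow> 'd \<Rightarrow> real) \<Rightarrow>
     (nat \<Rightarrow> 'd \<Rightarrow> 'w \<Rightarrow> real) \<Rightarrow> (nat \<Rightarrow> 'w measure) \<Rightarrow> real" where
  "avg_leakage K \<nu> W prior post P =
     (1 / real K) * (\<Sum>k = 1..K. sqrt (JS_divergence
        (posterior_belief (\<nu> k) (post k) (W k) (P k)) (prior_belief (\<nu> k) (prior k))))"


section \<open>Utility loss\<close>

text \<open>
  A data set is a finite multiset of data points, and \<open>D\<^sub>k\<close> is a random data set
  \<^term>\<open>X :: 's \<Rightarrow> 'z multiset\<close> on a probability space \<open>\<Omega>\<close>.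
\<close>

definition client_utility ::
    "'s measure \<Rightarrow> ('s \<Rightarrow> 'z multiset) \<Rightarrow> ('w \<Rightarrow> 'z \<Rightarrow> real) \<Rightarrow> 'w \<Rightarrow> real" where
  "client_utility \<Omega> X U w = (LINT \<omega>|\<Omega>. (1 / real (size (X \<omega>))) * (\<Sum>d\<in>#X \<omega>. U w d))"

definition client_utility_dist ::
    "'s measure \<Rightarrow> ('s \<Rightarrow> 'z multiset) \<Rightarrow> ('w \<Rightarrow> 'z \<Rightarrow> real) \<Rightarrow> 'w measure \<Rightarrow> real" where
  "client_utility_dist \<Omega> X U P = (LINT w|P. client_utility \<Omega> X U w)"

definition utility_loss ::
    "nat \<Rightarrow> 's measure \<Rightarrow> (nat \<Rightarrow> 's \<Rightarrow> 'z multiset) \<Rightarrow> ('w \<Rightarrow> 'z \<Rightarrow> real) \<Rightarrow>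
     'w measure \<Rightarrow> 'w measure \<Rightarrow> real" where
  "utility_loss K \<Omega> X U PaO PaS =
     (1 / real K) * (\<Sum>k = 1..K.
        client_utility_dist \<Omega> (X k) U PaO - client_utility_dist \<Omega> (X k) U PaS)"

definition utility_constant ::
    "nat \<Rightarrow> (nat \<Rightarrow> 'z multiset measure) \<Rightarrow> (nat \<Rightarrow> 'w set) \<Rightarrow> ('w \<Rightarrow> 'z \<Rightarrow> real) \<Rightarrow>
     real \<Rightarrow> bool" where
  "utility_constant K \<nu> W U C \<longleftrightarrow>
     (\<forall>k\<in>{1..K}. \<forall>w\<in>W k. \<forall>D\<in>space (\<nu> k). \<forall>d\<in>#D. sqrt 2 * U w d \<le> C)"

end

theory Submission
  imports Defs
begin

text \<open>
  For diagonal covariances \<open>h\<close> is the Hellinger distance \<open>sqrt (1 - \<rho>)\<close> of the two Gaussians, where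
  the affinity \<open>\<rho>\<close> factorises over the coordinates, so that the common block contributes \<open>1\<close>.
  By the Cauchy--Schwarz inequality the total variation distance is at most \<open>sqrt 2 h\<close>, which
  bounds the utility loss in terms of the averaged Gaussians; their \<open>h\<close> is at most
  \<open>sqrt K\<close> times that of the original ones.

  For the privacy bound the triangle inequality for \<open>sqrt JS\<close> is not needed. Since \<open>sqrt JS\<close> is an
  \<open>L\<^sup>2\<close> norm of the root of a pointwise divergence, and that root is Lipschitz in the square root of
  the density, the difference of the two leakages is at most the \<open>L\<^sup>2\<close> distance of the square roots
  of the densities. The ratio bounds given by \<open>\<xi>\<close> turn this into a multiple of the total variation
  distance.
\<close>

section \<open>Gaussians with diagonal covariance\<close>

lemma real_sqrt_prod: "sqrt (prod f A) = (\<Prod>x\<in>A. sqrt (f x))"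
  by (induction A rule: infinite_finite_induct) (simp_all add: real_sqrt_mult)

text \<open>Fubini for product integrands: Lebesgue measure factorises over \<open>Basis\<close>,
  and \<open>axis i 1\<close> identifies the index type with \<open>Basis\<close>.\<close>

lemma nn_integral_lborel_vec_prod:
  fixes f :: "'n::finite \<Rightarrow> real \<Rightarrow> ennreal"
  assumes [measurable]: "\<And>i. f i \<in> borel_measurable borel"
  shows "(\<integral>\<^sup>+ x. (\<Prod>i\<in>UNIV. f i (x $ i)) \<partial>(lborel :: (real ^ 'n) measure)) =
    (\<Prod>i\<in>UNIV. \<integral>\<^sup>+ t. f i t \<partial>lborel)"
proof -
  have bij: "bij_betw (\<lambda>i. axis i (1::real)) (UNIV :: 'n set) Basis"
    by (auto simp: bij_betw_def inj_on_def axis_eq_axis Basis_vec_def)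
  have "(\<integral>\<^sup>+ x. (\<Prod>b\<in>Basis. f (axis_index b) (x \<bullet> b)) \<partial>(lborel :: (real ^ 'n) measure)) =
      (\<Prod>b\<in>(Basis :: (real ^ 'n) set). \<integral>\<^sup>+ t. f (axis_index b) t \<partial>lborel)"
    by (rule nn_integral_lborel_prod) auto
  then show ?thesis
    by (simp add: prod.reindex_bij_betw[OF bij, symmetric] inner_axis)
qed

lemma matrix_inv_diagonal_mult:
  fixes S :: "real ^ 'n ^ 'n"
  assumes "diagonal_covariance S"
  shows "matrix_inv S *v x = (\<chi> i. x $ i / S $ i $ i)"
proof -
  have S: "\<And>i j. i \<noteq> j \<Longrightarrow> S $ i $ j = 0" "\<And>i. 0 < S $ i $ i"
    using assms by (auto simp: diagonal_covariance_def)
  \<comment> \<open>\<open>matrix_inv\<close> is given by choice, so its entries are not computed.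
    Instead \<open>S *v y = x\<close> is verified for this explicit \<open>y\<close>, and the left
    inverse is applied.\<close>
  define y :: "real ^ 'n" where "y = (\<chi> i. x $ i / S $ i $ i)"
  have "det S \<noteq> 0"
    using S by (subst det_diagonal) (auto simp: less_imp_neq[symmetric])
  then have "invertible S"
    by (simp add: invertible_det_nz)
  then have inv: "matrix_inv S ** S = mat 1"
    unfolding invertible_def matrix_inv_def by (rule someI2_ex) blast
  have "(\<Sum>j\<in>UNIV. S $ i $ j * y $ j) = x $ i" for i
  proof -
    have "(\<Sum>j\<in>UNIV. S $ i $ j * y $ j) = (\<Sum>j\<in>UNIV. if j = i then x $ i else 0)"
      using S(1)[of i] S(2)[of i] by (intro sum.cong) (auto simp: y_def)
    then show ?thesis by simp
  qed
  then have "S *v y = x"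
    by (simp add: matrix_vector_mult_def vec_eq_iff)
  then have "matrix_inv S *v x = y"
    by (metis inv matrix_vector_mul_assoc matrix_vector_mul_lid)
  then show ?thesis
    by (simp add: y_def)
qed

text \<open>\<open>normal_density\<close> takes a standard deviation, hence the root of the variance
  \<open>S $ i $ i\<close>. The product form reduces integrals over vectors to one-dimensional
  ones.\<close>

definition gauss_density :: "real ^ 'n \<Rightarrow> real ^ 'n ^ 'n \<Rightarrow> real ^ 'n \<Rightarrow> real" where
  "gauss_density \<mu> S x = (\<Prod>i\<in>UNIV. normal_density (\<mu> $ i) (sqrt (S $ i $ i)) (x $ i))"

lemma measurable_gauss_density [measurable]: "gauss_density \<mu> S \<in> borel_measurable borel"
  unfolding gauss_density_def by measurable

lemma gauss_density_pos:
  assumes "diagonal_covariance S"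
  shows "0 < gauss_density \<mu> S x"
  using assms unfolding gauss_density_def diagonal_covariance_def
  by (intro prod_pos normal_density_pos ballI) simp

text \<open>A diagonal covariance turns the quadratic form into a sum over coordinates and the
  determinant into a product, so both the exponential and the normalising constant
  factorise.\<close>

lemma mv_normal_eq_gauss_density:
  assumes "diagonal_covariance S"
  shows "mv_normal \<mu> S = density lborel (\<lambda>x. ennreal (gauss_density \<mu> S x))"
proof -
  have S: "\<And>i j. i \<noteq> j \<Longrightarrow> S $ i $ j = 0" "\<And>i. 0 < S $ i $ i"
    using assms by (auto simp: diagonal_covariance_def)
  have det: "det S = (\<Prod>i\<in>UNIV. S $ i $ i)"
    using S(1) by (rule det_diagonal)
  have quad: "(x - \<mu>) \<bullet> (matrix_inv S *v (x - \<mu>)) =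
      (\<Sum>i\<in>UNIV. (x $ i - \<mu> $ i)\<^sup>2 / S $ i $ i)" for x
    by (simp add: matrix_inv_diagonal_mult[OF assms] inner_vec_def power2_eq_square)
  have norm: "sqrt ((2 * pi) ^ CARD('a) * det S) = (\<Prod>i\<in>UNIV. sqrt (2 * pi * S $ i $ i))"
    by (simp add: det real_sqrt_prod[symmetric] prod.distrib)
  have "exp (- (1/2) * ((x - \<mu>) \<bullet> (matrix_inv S *v (x - \<mu>)))) /
      sqrt ((2 * pi) ^ CARD('a) * det S) = gauss_density \<mu> S x" for x
  proof -
    have "gauss_density \<mu> S x =
        (\<Prod>i\<in>UNIV. exp (- ((x $ i - \<mu> $ i)\<^sup>2 / S $ i $ i) / 2) / sqrt (2 * pi * S $ i $ i))"
      unfolding gauss_density_def normal_density_def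
      using S(2) by (intro prod.cong refl) (simp add: less_imp_le field_simps)
    also have "\<dots> = exp (\<Sum>i\<in>UNIV. - ((x $ i - \<mu> $ i)\<^sup>2 / S $ i $ i) / 2) /
        (\<Prod>i\<in>UNIV. sqrt (2 * pi * S $ i $ i))"
      by (simp add: prod_dividef exp_sum)
    also have "(\<Sum>i\<in>UNIV. - ((x $ i - \<mu> $ i)\<^sup>2 / S $ i $ i) / 2) =
        - (1/2) * ((x - \<mu>) \<bullet> (matrix_inv S *v (x - \<mu>)))"
      by (simp add: quad sum_distrib_left sum_negf sum_divide_distrib mult.commute)
    finally show ?thesis
      by (simp only: norm)
  qed
  then show ?thesis
    by (simp only: mv_normal_def)
qed

lemma nn_integral_gauss_density:
  assumes "diagonal_covariance S"
  shows "(\<integral>\<^sup>+ x. ennreal (gauss_density \<mu> S x) \<partial>lborel) = 1"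
proof -
  have S: "\<And>i. 0 < S $ i $ i"
    using assms by (auto simp: diagonal_covariance_def)
  have "(\<integral>\<^sup>+ x. ennreal (gauss_density \<mu> S x) \<partial>lborel) =
      (\<Prod>i\<in>UNIV. \<integral>\<^sup>+ t. ennreal (normal_density (\<mu> $ i) (sqrt (S $ i $ i)) t) \<partial>lborel)"
    unfolding gauss_density_def
    by (subst nn_integral_lborel_vec_prod[symmetric]) (auto simp: prod_ennreal)
  also have "\<dots> = 1"
    using S by (simp add: nn_integral_eq_integral)
  finally show ?thesis .
qed

section \<open>Hellinger affinity of two Gaussians and its relation to \<open>h_dist\<close>\<close>

definition normal_affinity :: "real \<Rightarrow> real \<Rightarrow> real \<Rightarrow> real \<Rightarrow> real" where
  "normal_affinity a v b w =
     sqrt (sqrt (v * w) / ((v + w) / 2)) * exp (- (1/8) * ((a - b)\<^sup>2 / ((v + w) / 2)))"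

text \<open>Completing the square: the geometric mean of two normal densities is a multiple of the
  normal density with the precision-weighted mean and the harmonic mean of the variances.
  Integrating identifies the multiple as the Hellinger affinity, the integral of the root of the
  product; \<open>v\<close> and \<open>w\<close> are variances.\<close>

lemma sqrt_normal_density_mult:
  assumes "0 < v" "0 < w"
  shows "sqrt (normal_density a (sqrt v) x * normal_density b (sqrt w) x) =
    normal_affinity a v b w *
      normal_density ((a * w + b * v) / (v + w)) (sqrt (2 * v * w / (v + w))) x"
proof -
  define m where "m = (a * w + b * v) / (v + w)"
  define \<tau> where "\<tau> = 2 * v * w / (v + w)"
  have \<tau>: "0 < \<tau>" using assms by (simp add: \<tau>_def)
  have expo: "(- (x - a)\<^sup>2 / (2 * v) + - (x - b)\<^sup>2 / (2 * w)) / 2 =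
      - (1/8) * ((a - b)\<^sup>2 / ((v + w) / 2)) + - (x - m)\<^sup>2 / (2 * \<tau>)"
  proof -
    have vw: "v + w \<noteq> 0" "v \<noteq> 0" "w \<noteq> 0" using assms by auto
    have "(x - m) = ((x - a) * w + (x - b) * v) / (v + w)"
      using vw by (simp add: m_def field_simps)
    then have m: "(x - m)\<^sup>2 / (2 * \<tau>) = ((x - a) * w + (x - b) * v)\<^sup>2 / (4 * v * w * (v + w))"
      using vw by (simp add: \<tau>_def power_divide power2_eq_square)
    \<comment> \<open>Written in the two differences \<open>p\<close> and \<open>q\<close>, the
      claim is a rational identity in \<open>p\<close>, \<open>q\<close>, \<open>v\<close>,
      \<open>w\<close>.\<close>
    have "a - b = (x - b) - (x - a)" by simp
    then obtain p q where pq: "x - a = p" "x - b = q" "a - b = q - p" by blast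
    show ?thesis
      unfolding minus_divide_left[symmetric] m pq using vw
      by (simp add: divide_simps) (simp add: algebra_simps power2_eq_square)
  qed
  have const: "1 / sqrt (sqrt (2 * pi * v) * sqrt (2 * pi * w)) =
      sqrt (sqrt (v * w) / ((v + w) / 2)) / sqrt (2 * pi * \<tau>)"
  proof -
    have r: "sqrt (v * w) * sqrt (v * w) = v * w" using assms by simp
    have "sqrt (2 * pi * v) * sqrt (2 * pi * w) = sqrt ((2 * pi)\<^sup>2 * (v * w))"
      by (simp add: real_sqrt_mult[symmetric] power2_eq_square algebra_simps)
    also have "\<dots> = 2 * pi * sqrt (v * w)"
      by (simp add: real_sqrt_mult)
    finally have "1 / (sqrt (2 * pi * v) * sqrt (2 * pi * w)) =
        (sqrt (v * w) / ((v + w) / 2)) / (2 * pi * \<tau>)"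
      using assms r by (simp add: \<tau>_def divide_simps) 
    then show ?thesis
      by (metis real_sqrt_divide real_sqrt_one)
  qed
  have sqrt_exp: "sqrt (exp y) = exp (y / 2)" for y :: real
    by (rule real_sqrt_unique) (simp_all add: power2_eq_square exp_add[symmetric])
  have "normal_density a (sqrt v) x * normal_density b (sqrt w) x =
     (1 / (sqrt (2 * pi * v) * sqrt (2 * pi * w))) *
      exp (- (x - a)\<^sup>2 / (2 * v) + - (x - b)\<^sup>2 / (2 * w))"
    using assms unfolding exp_add by (simp add: normal_density_def)
  then have "sqrt (normal_density a (sqrt v) x * normal_density b (sqrt w) x) =
     (1 / sqrt (sqrt (2 * pi * v) * sqrt (2 * pi * w))) *
      exp ((- (x - a)\<^sup>2 / (2 * v) + - (x - b)\<^sup>2 / (2 * w)) / 2)"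
    by (simp add: real_sqrt_mult real_sqrt_divide sqrt_exp)
  also have "\<dots> = normal_affinity a v b w * normal_density m (sqrt \<tau>) x"
    unfolding const expo exp_add normal_affinity_def normal_density_def
    using \<tau> by simp
  finally show ?thesis
    by (simp add: m_def \<tau>_def)
qed


text \<open>AM-GM bounds the variance factor by 1, and the exponent of the other factor is
  nonpositive.\<close>

lemma normal_affinity_bounds:
  assumes "0 < v" "0 < w"
  shows "0 \<le> normal_affinity a v b w" "normal_affinity a v b w \<le> 1"
proof -
  have "sqrt (v * w) \<le> (v + w) / 2"
    using assms by (intro arith_geo_mean_sqrt) auto
  then have "sqrt (v * w) / ((v + w) / 2) \<le> 1"
    using assms by (simp add: divide_simps)
  then have "sqrt (sqrt (v * w) / ((v + w) / 2)) \<le> 1"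
    by simp
  moreover have "exp (- (1/8) * ((a - b)\<^sup>2 / ((v + w) / 2))) \<le> 1"
    using assms by simp
  moreover show "0 \<le> normal_affinity a v b w"
    using assms by (simp add: normal_affinity_def)
  ultimately show "normal_affinity a v b w \<le> 1"
    using assms by (auto simp: normal_affinity_def intro!: mult_le_one)
qed

lemma normal_affinity_self: "0 < v \<Longrightarrow> normal_affinity a v a v = 1"
  by (simp add: normal_affinity_def)

definition gauss_affinity ::
    "real ^ 'n \<Rightarrow> real ^ 'n ^ 'n \<Rightarrow> real ^ 'n \<Rightarrow> real ^ 'n ^ 'n \<Rightarrow> real" where
  "gauss_affinity \<mu>1 S1 \<mu>2 S2 =
     (\<Prod>i\<in>UNIV. normal_affinity (\<mu>1 $ i) (S1 $ i $ i) (\<mu>2 $ i) (S2 $ i $ i))"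

lemma gauss_affinity_bounds:
  assumes "diagonal_covariance S1" "diagonal_covariance S2"
  shows "0 \<le> gauss_affinity \<mu>1 S1 \<mu>2 S2" "gauss_affinity \<mu>1 S1 \<mu>2 S2 \<le> 1"
  using assms unfolding gauss_affinity_def diagonal_covariance_def
  by (auto intro!: prod_nonneg prod_le_1 normal_affinity_bounds)

text \<open>The root of the product factorises over the coordinates, so Fubini leaves
  one-dimensional integrals of multiples of normal densities.\<close>

lemma nn_integral_sqrt_gauss_density:
  assumes "diagonal_covariance S1" "diagonal_covariance S2"
  shows "(\<integral>\<^sup>+ x. ennreal (sqrt (gauss_density \<mu>1 S1 x * gauss_density \<mu>2 S2 x)) \<partial>lborel) =
    ennreal (gauss_affinity \<mu>1 S1 \<mu>2 S2)"
proof -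
  have S: "\<And>i. 0 < S1 $ i $ i" "\<And>i. 0 < S2 $ i $ i"
    using assms by (auto simp: diagonal_covariance_def)
  define f where "f i t = sqrt (normal_density (\<mu>1 $ i) (sqrt (S1 $ i $ i)) t *
     normal_density (\<mu>2 $ i) (sqrt (S2 $ i $ i)) t)" for i t
  have f_meas: "(\<lambda>t. ennreal (f i t)) \<in> borel_measurable borel" for i
    unfolding f_def by measurable
  have f_nonneg: "0 \<le> f i t" for i t
    by (simp add: f_def)
  have f_int: "(\<integral>\<^sup>+ t. ennreal (f i t) \<partial>lborel) =
      ennreal (normal_affinity (\<mu>1 $ i) (S1 $ i $ i) (\<mu>2 $ i) (S2 $ i $ i))" for i
    using S[of i] normal_affinity_bounds(1)[OF S, of "\<mu>1 $ i" i "\<mu>2 $ i" i]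
    by (simp add: f_def sqrt_normal_density_mult ennreal_mult nn_integral_cmult
        nn_integral_eq_integral)
  have "(\<integral>\<^sup>+ x. ennreal (sqrt (gauss_density \<mu>1 S1 x * gauss_density \<mu>2 S2 x)) \<partial>lborel) =
      (\<integral>\<^sup>+ x. (\<Prod>i\<in>UNIV. ennreal (f i (x $ i))) \<partial>lborel)"
    by (simp add: gauss_density_def prod.distrib[symmetric] real_sqrt_prod f_def prod_ennreal)
  also have "\<dots> = (\<Prod>i\<in>UNIV. \<integral>\<^sup>+ t. ennreal (f i t) \<partial>lborel)"
    by (rule nn_integral_lborel_vec_prod) (rule f_meas)
  also have "\<dots> = ennreal (gauss_affinity \<mu>1 S1 \<mu>2 S2)"
    using S by (simp add: f_int gauss_affinity_def prod_ennreal normal_affinity_bounds)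
  finally show ?thesis .
qed

lemma h_dist_eq_gauss_affinity:
  assumes "diagonal_covariance S1" "diagonal_covariance S2"
  shows "h_dist \<mu>1 S1 \<mu>2 S2 = sqrt (1 - gauss_affinity \<mu>1 S1 \<mu>2 S2)"
proof -
  have S: "\<And>i j. i \<noteq> j \<Longrightarrow> S1 $ i $ j = 0" "\<And>i. 0 < S1 $ i $ i"
    "\<And>i j. i \<noteq> j \<Longrightarrow> S2 $ i $ j = 0" "\<And>i. 0 < S2 $ i $ i"
    using assms by (auto simp: diagonal_covariance_def)
  define M where "M = (1/2) *\<^sub>R (S1 + S2)"
  have M_ii: "M $ i $ i = (S1 $ i $ i + S2 $ i $ i) / 2" for i
    by (simp add: M_def)
  have M: "diagonal_covariance M"
    using S by (simp add: diagonal_covariance_def M_def add_pos_pos)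
  have det: "det S1 = (\<Prod>i\<in>UNIV. S1 $ i $ i)" "det S2 = (\<Prod>i\<in>UNIV. S2 $ i $ i)"
    "det M = (\<Prod>i\<in>UNIV. M $ i $ i)"
    using S M by (auto intro!: det_diagonal simp: diagonal_covariance_def)
  \<comment> \<open>In each coordinate the fractional powers coming from the determinants regroup
    into the nested root of \<open>normal_affinity\<close>.\<close>
  have factor: "v powr (1/4) * w powr (1/4) / u powr (1/2) = sqrt (sqrt (v * w) / u)"
    if "0 < v" "0 < w" "0 < u" for u v w :: real
  proof -
    have "v powr (1/4) * w powr (1/4) = ((v * w) powr (1/2)) powr (1/2)"
      using that by (simp add: powr_mult powr_powr)
    also have "\<dots> / u powr (1/2) = sqrt (sqrt (v * w) / u)"
      using that by (simp add: powr_half_sqrt real_sqrt_divide)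
    finally show ?thesis .
  qed
  have quad: "(\<mu>1 - \<mu>2) \<bullet> (matrix_inv M *v (\<mu>1 - \<mu>2)) =
      (\<Sum>i\<in>UNIV. (\<mu>1 $ i - \<mu>2 $ i)\<^sup>2 / M $ i $ i)"
    by (simp add: matrix_inv_diagonal_mult[OF M] inner_vec_def power2_eq_square)
  have "det S1 powr (1/4) * det S2 powr (1/4) / det M powr (1/2) *
      exp (- (1/8) * ((\<mu>1 - \<mu>2) \<bullet> (matrix_inv M *v (\<mu>1 - \<mu>2)))) =
      (\<Prod>i\<in>UNIV. (S1 $ i $ i) powr (1/4) * (S2 $ i $ i) powr (1/4) / (M $ i $ i) powr (1/2) *
        exp (- (1/8) * ((\<mu>1 $ i - \<mu>2 $ i)\<^sup>2 / M $ i $ i)))"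
    unfolding det quad prod_powr_distrib sum_distrib_left
    by (simp add: exp_sum prod_dividef prod.distrib)
  also have "\<dots> = gauss_affinity \<mu>1 S1 \<mu>2 S2"
    unfolding gauss_affinity_def normal_affinity_def M_ii[symmetric]
    using S M by (intro prod.cong refl arg_cong2[where f="(*)"] factor)
      (auto simp: diagonal_covariance_def)
  finally show ?thesis
    by (simp add: h_dist_def M_def[symmetric])
qed

lemma h_dist_nonneg:
  assumes "diagonal_covariance S1" "diagonal_covariance S2"
  shows "0 \<le> h_dist \<mu>1 S1 \<mu>2 S2"
  using gauss_affinity_bounds(2)[OF assms] by (simp add: h_dist_eq_gauss_affinity[OF assms])

section \<open>Block structure, scaling and support of diagonal Gaussians\<close>

lemma diagonal_covariance_scaleR:
  "diagonal_covariance S \<Longrightarrow> 0 < c \<Longrightarrow> diagonal_covariance (c *\<^sub>R S)"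
  by (simp add: diagonal_covariance_def)

lemma diagonal_covariance_block_diag:
  assumes "diagonal_covariance A" "diagonal_covariance B"
  shows "diagonal_covariance (block_diag A B)"
  using assms by (auto simp: diagonal_covariance_def block_diag_def split: sum.split)

lemma block_diag_scaleR: "c *\<^sub>R block_diag A B = block_diag (c *\<^sub>R A) (c *\<^sub>R B)"
  by (auto simp: block_diag_def vec_eq_iff split: sum.split)

lemma gauss_affinity_block:
  fixes \<mu>u :: "real ^ 'm" and \<mu>o \<mu>g :: "real ^ 'o"
  assumes "diagonal_covariance Su"
  shows "gauss_affinity (vec_append \<mu>u \<mu>o) (block_diag Su So) (vec_append \<mu>u \<mu>g) (block_diag Su Sg) =
    gauss_affinity \<mu>o So \<mu>g Sg"
proof -
  have "(\<Prod>i\<in>(UNIV :: ('m + 'o) set). f i) = (\<Prod>i\<in>UNIV. f (Inl i)) * (\<Prod>i\<in>UNIV. f (Inr i))"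
    for f :: "'m + 'o \<Rightarrow> real"
    unfolding UNIV_Plus_UNIV[symmetric] by (subst prod.Plus) auto
  then show ?thesis
    using assms
    by (simp add: gauss_affinity_def vec_append_def block_diag_def diagonal_covariance_def
        normal_affinity_self)
qed

text \<open>Dividing both variances by \<open>K\<close> leaves the variance factor \<open>r\<close>
  unchanged and multiplies the exponent \<open>e\<close> by \<open>K\<close>. The scaled affinity is
  thus \<open>r * exp e ^ K\<close>, and \<open>r ^ K\<close> is at most \<open>r\<close> because
  \<open>r\<close> lies in [0, 1].\<close>

lemma normal_affinity_scaled:
  assumes "0 < v" "0 < w" "1 \<le> K"
  shows "normal_affinity a v b w ^ K \<le> normal_affinity a (v / real K) b (w / real K)"
proof -
  define r where "r = sqrt (sqrt (v * w) / ((v + w) / 2))"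
  define e where "e = - (1/8) * ((a - b)\<^sup>2 / ((v + w) / 2))"
  have K: "0 < real K" using assms by simp
  have r: "sqrt (sqrt (v / real K * (w / real K)) / ((v / real K + w / real K) / 2)) = r"
  proof -
    have "v / real K * (w / real K) = v * w / (real K)\<^sup>2"
      by (simp add: power2_eq_square)
    then have "sqrt (v / real K * (w / real K)) = sqrt (v * w) / real K"
      using K by (simp add: real_sqrt_divide)
    then show ?thesis
      using K assms by (simp add: r_def divide_simps)
  qed
  have e: "- (1/8) * ((a - b)\<^sup>2 / ((v / real K + w / real K) / 2)) = real K * e"
    using K by (simp add: e_def add_divide_distrib[symmetric])
  have "sqrt (v * w) \<le> (v + w) / 2"
    using assms by (intro arith_geo_mean_sqrt) auto
  then have "sqrt (v * w) / ((v + w) / 2) \<le> 1"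
    using assms by (simp add: divide_simps)
  then have "0 \<le> r" "r \<le> 1"
    using assms by (auto simp: r_def)
  then have "r ^ K \<le> r"
    using assms(3) power_decreasing[of 1 K r] by simp
  then show ?thesis
    unfolding normal_affinity_def r e r_def[symmetric] e_def[symmetric]
    by (simp add: power_mult_distrib exp_of_nat_mult)
qed

text \<open>
  Dividing both covariances by \<open>K\<close> multiplies only the exponent in \<open>h\<close>, so the affinity \<open>\<rho>\<close>
  becomes at least \<open>\<rho>\<^sup>K\<close>, and Bernoulli's inequality gives \<open>1 - \<rho>\<^sup>K \<le> K (1 - \<rho>)\<close>.
\<close>

lemma h_dist_scaled_le:
  assumes "diagonal_covariance S1" "diagonal_covariance S2" "1 \<le> K"
  shows "h_dist \<mu>1 ((1 / real K) *\<^sub>R S1) \<mu>2 ((1 / real K) *\<^sub>R S2) \<le> sqrt (real K) * h_dist \<mu>1 S1 \<mu>2 S2"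
proof -
  let ?a = "gauss_affinity \<mu>1 S1 \<mu>2 S2"
  have scaled: "diagonal_covariance ((1 / real K) *\<^sub>R S1)" "diagonal_covariance ((1 / real K) *\<^sub>R S2)"
    using assms by (auto intro!: diagonal_covariance_scaleR)
  have a: "0 \<le> ?a" "?a \<le> 1"
    using gauss_affinity_bounds assms by auto
  have "?a ^ K \<le> gauss_affinity \<mu>1 ((1 / real K) *\<^sub>R S1) \<mu>2 ((1 / real K) *\<^sub>R S2)"
    unfolding gauss_affinity_def prod_power_distrib
    using assms by (intro prod_mono)
      (auto simp: diagonal_covariance_def normal_affinity_bounds normal_affinity_scaled)
  moreover have "1 - real K * (1 - ?a) \<le> ?a ^ K"
    using Bernoulli_inequality[of "?a - 1" K] a by (simp add: algebra_simps)
  ultimately have "1 - gauss_affinity \<mu>1 ((1 / real K) *\<^sub>R S1) \<mu>2 ((1 / real K) *\<^sub>R S2) \<le>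
      real K * (1 - ?a)"
    by linarith
  then show ?thesis
    unfolding h_dist_eq_gauss_affinity[OF scaled] h_dist_eq_gauss_affinity[OF assms(1,2)]
    by (simp add: real_sqrt_mult[symmetric])
qed

text \<open>The density is positive everywhere, so an open set of Gaussian measure zero would be
  Lebesgue null, which a nonempty open set is not.\<close>

lemma measure_support_mv_normal:
  assumes "diagonal_covariance S"
  shows "measure_support (mv_normal \<mu> S) = UNIV"
proof -
  have "0 < emeasure (mv_normal \<mu> S) A" if "open A" "x \<in> A" for x A
  proof (rule ccontr)
    assume "\<not> 0 < emeasure (mv_normal \<mu> S) A"
    then have "(\<integral>\<^sup>+ y. ennreal (gauss_density \<mu> S y) * indicator A y \<partial>lborel) = 0"
      using that by (simp add: mv_normal_eq_gauss_density[OF assms] emeasure_density)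
    then have "AE y in lborel. ennreal (gauss_density \<mu> S y) * indicator A y = 0"
      using that by (subst (asm) nn_integral_0_iff_AE) auto
    then have "AE y in lborel. y \<notin> A"
      by eventually_elim
        (use gauss_density_pos[OF assms] in \<open>auto simp: indicator_def ennreal_eq_0_iff not_less[symmetric] split: if_splits\<close>)
    then have "emeasure lborel A = 0"
      using that by (simp add: AE_iff_measurable[of A])
    moreover have "A \<notin> null_sets lborel"
      using that open_not_negligible null_sets_completionI
      by (metis empty_iff negligible_iff_null_sets)
    ultimately show False
      using that by (auto simp: null_sets_def)
  qed
  then show ?thesis
    by (auto simp: measure_support_def)
qed

section \<open>Hellinger affinity and total variation\<close>

text \<open>Transfer of the inequality for nonnegative integrals, applied to the absolute values.
  The product is integrable because \<open>\<bar>a * b\<bar>\<close> is at most the sum of the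
  squares.\<close>

lemma Cauchy_Schwarz_integral:
  fixes f g :: "'a \<Rightarrow> real"
  assumes [measurable]: "f \<in> borel_measurable M" "g \<in> borel_measurable M"
    and f2: "integrable M (\<lambda>x. (f x)\<^sup>2)" and g2: "integrable M (\<lambda>x. (g x)\<^sup>2)"
  shows "integrable M (\<lambda>x. f x * g x)"
    and "(\<integral>x. \<bar>f x * g x\<bar> \<partial>M) \<le> sqrt (\<integral>x. (f x)\<^sup>2 \<partial>M) * sqrt (\<integral>x. (g x)\<^sup>2 \<partial>M)"
proof -
  show int: "integrable M (\<lambda>x. f x * g x)"
  proof (rule Bochner_Integration.integrable_bound)
    show "integrable M (\<lambda>x. (f x)\<^sup>2 + (g x)\<^sup>2)" using f2 g2 by simp
    have "\<bar>a * b\<bar> \<le> a\<^sup>2 + b\<^sup>2" for a b :: real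
      using sum_squares_bound[of "\<bar>a\<bar>" "\<bar>b\<bar>"] abs_ge_zero[of "a * b"]
      unfolding abs_mult power2_abs by linarith
    then show "AE x in M. norm (f x * g x) \<le> norm ((f x)\<^sup>2 + (g x)\<^sup>2)" by simp
  qed measurable
  have "ennreal ((\<integral>x. \<bar>f x * g x\<bar> \<partial>M)\<^sup>2) = (\<integral>\<^sup>+ x. ennreal \<bar>f x\<bar> * ennreal \<bar>g x\<bar> \<partial>M)\<^sup>2"
    using nn_integral_eq_integral[OF integrable_abs[OF int]]
    by (simp add: ennreal_mult abs_mult ennreal_power)
  also have "\<dots> \<le> (\<integral>\<^sup>+ x. (ennreal \<bar>f x\<bar>)\<^sup>2 \<partial>M) * (\<integral>\<^sup>+ x. (ennreal \<bar>g x\<bar>)\<^sup>2 \<partial>M)"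
    by (rule Cauchy_Schwarz_nn_integral) measurable
  also have "\<dots> = ennreal ((\<integral>x. (f x)\<^sup>2 \<partial>M) * (\<integral>x. (g x)\<^sup>2 \<partial>M))"
    using f2 g2 by (simp add: ennreal_power nn_integral_eq_integral ennreal_mult)
  finally have "(\<integral>x. \<bar>f x * g x\<bar> \<partial>M)\<^sup>2 \<le> (\<integral>x. (f x)\<^sup>2 \<partial>M) * (\<integral>x. (g x)\<^sup>2 \<partial>M)"
    by (subst (asm) ennreal_le_iff) auto
  then show "(\<integral>x. \<bar>f x * g x\<bar> \<partial>M) \<le> sqrt (\<integral>x. (f x)\<^sup>2 \<partial>M) * sqrt (\<integral>x. (g x)\<^sup>2 \<partial>M)"
    unfolding real_sqrt_mult[symmetric] by (rule real_le_rsqrt)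
qed

text \<open>Factor \<open>p - q\<close> as the difference times the sum of the square roots and
  apply Cauchy-Schwarz. The squares of the two factors integrate to \<open>2 - 2 * \<rho>\<close>
  and \<open>2 + 2 * \<rho>\<close>, and the latter is at most 4.\<close>

lemma integral_abs_diff_le_affinity:
  fixes p q :: "'a \<Rightarrow> real"
  assumes p: "integrable M p" "\<And>x. 0 \<le> p x" "(\<integral>x. p x \<partial>M) = 1"
    and q: "integrable M q" "\<And>x. 0 \<le> q x" "(\<integral>x. q x \<partial>M) = 1"
    and \<rho>: "(\<integral>x. sqrt (p x * q x) \<partial>M) = \<rho>" "\<rho> \<le> 1"
  shows "(\<integral>x. \<bar>p x - q x\<bar> \<partial>M) \<le> 2 * sqrt 2 * sqrt (1 - \<rho>)"
proof -
  have [measurable]: "p \<in> borel_measurable M" "q \<in> borel_measurable M"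
    using p q by auto
  have pq: "integrable M (\<lambda>x. sqrt (p x * q x))"
  proof (rule Bochner_Integration.integrable_bound)
    show "integrable M (\<lambda>x. p x + q x)" using p q by simp
    show "AE x in M. norm (sqrt (p x * q x)) \<le> norm (p x + q x)"
    proof (rule AE_I2)
      fix x
      have "sqrt (p x * q x) \<le> (p x + q x) / 2"
        using p(2) q(2) by (rule arith_geo_mean_sqrt)
      then show "norm (sqrt (p x * q x)) \<le> norm (p x + q x)"
        using p(2)[of x] q(2)[of x] by simp
    qed
  qed measurable
  have minus: "(sqrt (p x) - sqrt (q x))\<^sup>2 = p x + q x - 2 * sqrt (p x * q x)" for x
    using p(2)[of x] q(2)[of x] by (simp add: power2_diff real_sqrt_mult)
  have plus: "(sqrt (p x) + sqrt (q x))\<^sup>2 = p x + q x + 2 * sqrt (p x * q x)" for x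
    using p(2)[of x] q(2)[of x] by (simp add: power2_sum real_sqrt_mult)
  have prod: "p x - q x = (sqrt (p x) - sqrt (q x)) * (sqrt (p x) + sqrt (q x))" for x
    using p(2)[of x] q(2)[of x] by (simp add: algebra_simps)
  have "(\<integral>x. \<bar>p x - q x\<bar> \<partial>M) \<le>
      sqrt (\<integral>x. (sqrt (p x) - sqrt (q x))\<^sup>2 \<partial>M) * sqrt (\<integral>x. (sqrt (p x) + sqrt (q x))\<^sup>2 \<partial>M)"
    unfolding prod by (rule Cauchy_Schwarz_integral(2)) (use p q pq in \<open>simp_all add: minus plus\<close>)
  also have "\<dots> = sqrt (2 - 2 * \<rho>) * sqrt (2 + 2 * \<rho>)"
    using p q pq \<rho> by (simp add: minus plus)
  also have "\<dots> \<le> sqrt (2 - 2 * \<rho>) * sqrt 4"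
    using \<rho> by (intro mult_left_mono real_sqrt_le_mono) auto
  also have "\<dots> = 2 * sqrt 2 * sqrt (1 - \<rho>)"
    by (simp add: real_sqrt_mult[symmetric])
  finally show ?thesis .
qed

lemma integral_density_diff_le:
  fixes f p q :: "'a \<Rightarrow> real"
  assumes p: "integrable M p" "\<And>x. 0 \<le> p x" "(\<integral>x. p x \<partial>M) = 1"
    and q: "integrable M q" "\<And>x. 0 \<le> q x" "(\<integral>x. q x \<partial>M) = 1"
    and f [measurable]: "f \<in> borel_measurable M" "\<And>x. x \<in> space M \<Longrightarrow> l \<le> f x" "\<And>x. x \<in> space M \<Longrightarrow> f x \<le> u"
  shows "\<bar>(\<integral>x. f x \<partial>density M (\<lambda>x. ennreal (p x))) - (\<integral>x. f x \<partial>density M (\<lambda>x. ennreal (q x)))\<bar>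
    \<le> (u - l) / 2 * (\<integral>x. \<bar>p x - q x\<bar> \<partial>M)"
proof -
  \<comment> \<open>As both densities have mass 1, subtracting a constant from \<open>f\<close>
    leaves the difference of expectations unchanged. The midpoint of the range minimises the
    remaining sup norm, to half the width.\<close>
  define c where "c = (l + u) / 2"
  have [measurable]: "p \<in> borel_measurable M" "q \<in> borel_measurable M"
    using p q by auto
  have f_abs: "\<bar>f x - c\<bar> \<le> (u - l) / 2" if "x \<in> space M" for x
    using f(2,3)[OF that] by (auto simp: c_def abs_le_iff field_simps)
  have int: "integrable M (\<lambda>x. r x * (f x - c))" if "integrable M r" for r
  proof (rule Bochner_Integration.integrable_bound)
    show "integrable M (\<lambda>x. r x * ((u - l) / 2))" using that by simp
    show "AE x in M. norm (r x * (f x - c)) \<le> norm (r x * ((u - l) / 2))"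
    proof (rule AE_I2)
      fix x assume "x \<in> space M"
      from f_abs[OF this] show "norm (r x * (f x - c)) \<le> norm (r x * ((u - l) / 2))"
        unfolding real_norm_def abs_mult by (intro mult_left_mono) auto
    qed
    show "(\<lambda>x. r x * (f x - c)) \<in> borel_measurable M"
      using that by measurable
  qed
  have eq: "(\<integral>x. f x \<partial>density M (\<lambda>x. ennreal (r x))) = (\<integral>x. r x * (f x - c) \<partial>M) + c"
    if r: "integrable M r" "\<And>x. 0 \<le> r x" "(\<integral>x. r x \<partial>M) = 1" for r
  proof -
    have [measurable]: "r \<in> borel_measurable M" using r by auto
    have "(\<integral>x. f x \<partial>density M (\<lambda>x. ennreal (r x))) = (\<integral>x. r x * (f x - c) + r x * c \<partial>M)"
      using r by (subst integral_density) (auto simp: algebra_simps)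
    also have "\<dots> = (\<integral>x. r x * (f x - c) \<partial>M) + (\<integral>x. r x * c \<partial>M)"
      using r int[OF r(1)] by (intro Bochner_Integration.integral_add) auto
    finally show ?thesis using r by simp
  qed
  have "\<bar>(\<integral>x. p x * (f x - c) \<partial>M) - (\<integral>x. q x * (f x - c) \<partial>M)\<bar> =
      \<bar>\<integral>x. (p x - q x) * (f x - c) \<partial>M\<bar>"
    using int[OF p(1)] int[OF q(1)] by (simp add: left_diff_distrib)
  also have "\<dots> \<le> (\<integral>x. \<bar>(p x - q x) * (f x - c)\<bar> \<partial>M)"
    by (rule integral_abs_bound)
  also have "\<dots> \<le> (\<integral>x. (u - l) / 2 * \<bar>p x - q x\<bar> \<partial>M)"
  proof (rule integral_mono)
    show "integrable M (\<lambda>x. \<bar>(p x - q x) * (f x - c)\<bar>)"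
      using p q by (intro integrable_abs int) auto
    show "integrable M (\<lambda>x. (u - l) / 2 * \<bar>p x - q x\<bar>)"
      using p q by simp
    fix x assume "x \<in> space M"
    from f_abs[OF this] show "\<bar>(p x - q x) * (f x - c)\<bar> \<le> (u - l) / 2 * \<bar>p x - q x\<bar>"
      unfolding abs_mult by (subst mult.commute) (intro mult_right_mono, auto)
  qed
  finally show ?thesis
    using p q by (simp add: eq)
qed

section \<open>Expectations of a bounded function under two Gaussians\<close>

lemma prob_space_mv_normal: "diagonal_covariance S \<Longrightarrow> prob_space (mv_normal \<mu> S)"
  by (rule prob_spaceI)
    (simp add: mv_normal_eq_gauss_density emeasure_density nn_integral_gauss_density)

lemma sets_mv_normal [measurable_cong]: "sets (mv_normal \<mu> S) = sets borel"
  by (simp add: mv_normal_def)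

lemma space_mv_normal [simp]: "space (mv_normal \<mu> S) = UNIV"
  by (simp add: mv_normal_def)

text \<open>Half the width of the range multiplies the L^1 distance of the densities, which the
  affinity bounds by \<open>2 * sqrt 2\<close> times \<open>h_dist\<close>.\<close>

lemma integral_mv_normal_diff_le:
  fixes f :: "real ^ 'n \<Rightarrow> real"
  assumes S: "diagonal_covariance S1" "diagonal_covariance S2"
    and f: "f \<in> borel_measurable borel" "\<And>x. l \<le> f x" "\<And>x. f x \<le> u"
  shows "\<bar>(\<integral>x. f x \<partial>mv_normal \<mu>1 S1) - (\<integral>x. f x \<partial>mv_normal \<mu>2 S2)\<bar>
    \<le> (u - l) * (sqrt 2 * h_dist \<mu>1 S1 \<mu>2 S2)"
proof -
  let ?p = "gauss_density \<mu>1 S1" and ?q = "gauss_density \<mu>2 S2"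
  let ?\<rho> = "gauss_affinity \<mu>1 S1 \<mu>2 S2"
  have dens: "integrable lborel (gauss_density \<mu> S)" "\<And>x. 0 \<le> gauss_density \<mu> S x"
    "(\<integral>x. gauss_density \<mu> S x \<partial>lborel) = 1" if S: "diagonal_covariance S" for \<mu> :: "real ^ 'n" and S
  proof -
    show nonneg: "0 \<le> gauss_density \<mu> S x" for x
      using gauss_density_pos[OF S] by (simp add: less_imp_le)
    show "integrable lborel (gauss_density \<mu> S)"
      using nonneg by (intro integrableI_nonneg) (auto simp: nn_integral_gauss_density[OF S])
    show "(\<integral>x. gauss_density \<mu> S x \<partial>lborel) = 1"
      using nonneg by (subst integral_eq_nn_integral) (auto simp: nn_integral_gauss_density[OF S])
  qed
  note p = dens[OF S(1), of \<mu>1] and q = dens[OF S(2), of \<mu>2]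
  have "(\<integral>x. sqrt (?p x * ?q x) \<partial>lborel) = ?\<rho>"
    using gauss_affinity_bounds(1)[OF S] p(2) q(2)
    by (subst integral_eq_nn_integral) (auto simp: nn_integral_sqrt_gauss_density[OF S])
  then have "(\<integral>x. \<bar>?p x - ?q x\<bar> \<partial>lborel) \<le> 2 * sqrt 2 * h_dist \<mu>1 S1 \<mu>2 S2"
    unfolding h_dist_eq_gauss_affinity[OF S]
    using gauss_affinity_bounds(2)[OF S] p q by (intro integral_abs_diff_le_affinity) auto
  then have "(u - l) / 2 * (\<integral>x. \<bar>?p x - ?q x\<bar> \<partial>lborel) \<le>
      (u - l) / 2 * (2 * sqrt 2 * h_dist \<mu>1 S1 \<mu>2 S2)"
    using order_trans[OF f(2,3)] by (intro mult_left_mono) auto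
  moreover have "\<bar>(\<integral>x. f x \<partial>mv_normal \<mu>1 S1) - (\<integral>x. f x \<partial>mv_normal \<mu>2 S2)\<bar> \<le>
      (u - l) / 2 * (\<integral>x. \<bar>?p x - ?q x\<bar> \<partial>lborel)"
    unfolding mv_normal_eq_gauss_density[OF S(1)] mv_normal_eq_gauss_density[OF S(2)]
    using p q f by (intro integral_density_diff_le) auto
  ultimately show ?thesis
    by simp
qed

lemma h_dist_block:
  fixes \<mu>u :: "real ^ 'm" and \<mu>o \<mu>g :: "real ^ 'o"
  assumes "diagonal_covariance Su" "diagonal_covariance So" "diagonal_covariance Sg"
  shows "h_dist (vec_append \<mu>u \<mu>o) (block_diag Su So) (vec_append \<mu>u \<mu>g) (block_diag Su Sg) =
    h_dist \<mu>o So \<mu>g Sg"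
  using assms
  by (simp add: h_dist_eq_gauss_affinity diagonal_covariance_block_diag gauss_affinity_block)

lemma model_space_mv_normal:
  assumes "diagonal_covariance S1"
  shows "model_space (\<lambda>k. mv_normal \<mu>1 S1) PS k = UNIV"
  by (simp add: model_space_def measure_support_mv_normal[OF assms])

section \<open>Jensen--Shannon divergence of comparable densities\<close>

text \<open>Twice the integrand of the Jensen-Shannon divergence, the factor 1/2 being left outside
  the integral.\<close>

definition js_term :: "real \<Rightarrow> real \<Rightarrow> real" where
  "js_term p q = p * ln (p / ((p + q) / 2)) + q * ln (q / ((p + q) / 2))"

text \<open>The difference of the two sides vanishes at 1, and the derivative of
  \<open>ln y - (y - 1 / y) / 2\<close> is minus half the square of \<open>1 - 1 / y\<close>, so
  that function decreases.\<close>

lemma ln_ge_half_diff_inverse: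
  fixes y :: real
  assumes "0 < y" "y \<le> 1"
  shows "(y - 1 / y) / 2 \<le> ln y"
proof -
  have "(\<lambda>y. ln y - (y - 1 / y) / 2) 1 \<le> (\<lambda>y. ln y - (y - 1 / y) / 2) y"
  proof (rule DERIV_nonpos_imp_nonincreasing[OF assms(2)], intro exI conjI)
    fix x :: real assume "y \<le> x" "x \<le> 1"
    then have "0 < x" using assms by simp
    then show "((\<lambda>y. ln y - (y - 1 / y) / 2) has_real_derivative (1 / x - (1 + 1 / (x * x)) / 2)) (at x)"
      by (auto intro!: derivative_eq_intros)
    show "1 / x - (1 + 1 / (x * x)) / 2 \<le> 0"
      using sum_squares_bound[of 1 "1 / x"] by (simp add: power2_eq_square)
  qed
  then show ?thesis by simp
qed

text \<open>Needed at \<open>t = - ln u\<close> in \<open>ln_square_le_js_term\<close>. The two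
  sides agree at 0, and quadratic Taylor bounds on \<open>exp x\<close> and \<open>exp (- x)\<close>
  make the derivative of their difference at least \<open>x * (2 - x)\<close>, whence the
  restriction to \<open>t \<le> 2\<close>.\<close>

lemma square_le_exp_combination:
  fixes t :: real
  assumes "0 \<le> t" "t \<le> 2"
  shows "t\<^sup>2 \<le> 2 * t + 3 * exp (- t) - 4 + exp t"
proof -
  let ?G = "\<lambda>t :: real. 2 * t + 3 * exp (- t) - 4 + exp t - t\<^sup>2"
  have "?G 0 \<le> ?G t"
  proof (rule DERIV_nonneg_imp_nondecreasing[OF assms(1)], intro exI conjI)
    fix x :: real assume x: "0 \<le> x" "x \<le> t"
    show "(?G has_real_derivative (2 - 3 * exp (- x) + exp x - 2 * x)) (at x)"
      by (auto intro!: derivative_eq_intros)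
    have e: "1 + x + x\<^sup>2 / 2 \<le> exp x"
      using x by (intro exp_lower_Taylor_quadratic)
    \<comment> \<open>The two quadratics multiply to at least 1, so the lower bound for
      \<open>exp x\<close> becomes an upper bound for \<open>exp (- x)\<close>.\<close>
    have "(1 - x + x\<^sup>2 / 2) * (1 + x + x\<^sup>2 / 2) = 1 + x ^ 4 / 4"
      by (simp add: algebra_simps power2_eq_square power4_eq_xxxx)
    moreover have "0 \<le> 1 - x + x\<^sup>2 / 2"
      using zero_le_power2[of "x - 1"] by (simp add: power2_diff)
    ultimately have "1 \<le> (1 - x + x\<^sup>2 / 2) * exp x"
      using mult_left_mono[OF e, of "1 - x + x\<^sup>2 / 2"] zero_le_power[OF x(1), of 4] by linarith
    then have "exp (- x) \<le> 1 - x + x\<^sup>2 / 2"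
      by (simp add: exp_minus field_simps)
    moreover have "x\<^sup>2 \<le> 2 * x"
      using x assms by (simp add: power2_eq_square mult_right_mono)
    ultimately show "0 \<le> 2 - 3 * exp (- x) + exp x - 2 * x"
      using e by linarith
  qed
  then show ?thesis by simp
qed

text \<open>Both sides are homogeneous of degree one, so dividing by \<open>p\<close> leaves an
  inequality in the single variable \<open>u\<close>, the ratio of the mean of \<open>p\<close> and
  \<open>q\<close> to \<open>p\<close>. The cases \<open>1 \<le> u\<close> and \<open>u < 1\<close>
  need different bounds for the logarithms.\<close>

lemma ln_square_le_js_term:
  assumes "0 < p" "0 < q"
  shows "p * (ln (p / ((p + q) / 2)))\<^sup>2 \<le> 2 * js_term p q"
proof -
  define x where "x = q / p"
  define u where "u = (1 + x) / 2"
  have x: "0 < x"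
    using assms by (simp add: x_def)
  then have u: "1 / 2 < u"
    by (simp add: u_def)
  have xu: "x = 2 * u - 1"
    by (simp add: u_def add_divide_distrib)
  have eqs: "p / ((p + q) / 2) = 1 / u" "q / ((p + q) / 2) = x / u"
    using assms by (auto simp: x_def u_def field_simps)
  have js: "js_term p q = p * (- ln u + x * ln (x / u))"
  proof -
    have "q = p * x" using assms by (simp add: x_def)
    moreover have "ln (1 / u) = - ln u" using u by (simp add: ln_div)
    ultimately show ?thesis
      unfolding js_term_def eqs by (simp add: algebra_simps)
  qed
  have "(ln u)\<^sup>2 \<le> 2 * (- ln u + x * ln (x / u))"
  proof (cases "1 \<le> u")
    case True
    \<comment> \<open>This gives \<open>x * ln (x / u) \<ge> x - u = u - 1\<close>; the square then
      comes from the quadratic Taylor bound for \<open>exp\<close> at \<open>ln u\<close>.\<close>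
    have "ln (u / x) \<le> u / x - 1"
      using x u by (intro ln_le_minus_one) auto
    then have "x * ln (u / x) \<le> u - x"
      using x by (simp add: field_simps)
    moreover have "ln (x / u) = - ln (u / x)"
      using x u by (simp add: ln_div)
    ultimately have "u - 1 \<le> x * ln (x / u)"
      using xu by simp
    moreover have "1 + ln u + (ln u)\<^sup>2 / 2 \<le> u"
      using exp_lower_Taylor_quadratic[of "ln u"] True by simp
    ultimately show ?thesis unfolding distrib_left by linarith
  next
    case False
    define t where "t = - ln u"
    have t: "0 \<le> t" "exp (- t) = u" "exp t = 1 / u"
      using u False by (auto simp: t_def exp_minus field_simps)
    have "ln (1 / u) \<le> 1 / u - 1"
      using u by (intro ln_le_minus_one) auto
    moreover have "1 / u \<le> 2" using u by (simp add: field_simps)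
    ultimately have "t \<le> 2" using u by (simp add: t_def ln_div)
    then have "t\<^sup>2 \<le> 2 * t + 3 * u - 4 + 1 / u"
      using square_le_exp_combination[of t] t by simp
    \<comment> \<open>Here \<open>x < u\<close>, so the sharper logarithm bound applies. With
      \<open>x = 2 * u - 1\<close> it yields exactly the remaining terms of
      \<open>square_le_exp_combination\<close>.\<close>
    moreover have "(x / u - 1 / (x / u)) / 2 \<le> ln (x / u)"
      using x u xu False by (intro ln_ge_half_diff_inverse) auto
    then have "x * ((x / u - 1 / (x / u)) / 2) \<le> x * ln (x / u)"
      using x by (intro mult_left_mono) auto
    moreover have "x * ((x / u - 1 / (x / u)) / 2) = (3 * u - 4 + 1 / u) / 2"
      using x u unfolding xu by (simp add: field_simps power2_eq_square)
    ultimately show ?thesis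
      unfolding t_def by simp
  qed
  then have "p * (ln u)\<^sup>2 \<le> p * (2 * (- ln u + x * ln (x / u)))"
    using assms by (intro mult_left_mono) auto
  moreover have "ln (1 / u) = - ln u"
    using u by (simp add: ln_div)
  ultimately show ?thesis
    unfolding eqs(1) js by (simp add: mult.left_commute)
qed

lemma js_term_nonneg: "0 < p \<Longrightarrow> 0 < q \<Longrightarrow> 0 \<le> js_term p q"
  using ln_square_le_js_term[of p q] by (smt (verit) mult_nonneg_nonneg zero_le_power2)

lemma js_term_has_derivative:
  assumes "0 < p" "0 < q"
  shows "((\<lambda>p. js_term p q) has_real_derivative ln (p / ((p + q) / 2))) (at p)"
proof -
  have eq: "js_term r q = r * (ln r - ln ((r + q) / 2)) + q * (ln q - ln ((r + q) / 2))"
    if "0 < r" for r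
    using that assms unfolding js_term_def by (subst (1 2) ln_divide_pos) auto
  have "((\<lambda>r. r * (ln r - ln ((r + q) / 2)) + q * (ln q - ln ((r + q) / 2)))
      has_real_derivative ln (p / ((p + q) / 2))) (at p)"
  proof -
    have "p / (p + q) + q / (p + q) = 1"
      using assms by (simp add: add_divide_distrib[symmetric])
    \<comment> \<open>Differentiating the logarithms contributes
      \<open>1 - p / (p + q) - q / (p + q) = 0\<close>, so only the logarithm of the ratio to the
      mean survives.\<close>
    then have "(ln p - ln ((p + q) / 2)) + p * (1 / p - 1 / (p + q)) - q / (p + q) = ln (p / ((p + q) / 2))"
      using assms by (subst ln_divide_pos) (auto simp: right_diff_distrib)
    moreover have "((\<lambda>r. r * (ln r - ln ((r + q) / 2)) + q * (ln q - ln ((r + q) / 2)))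
      has_real_derivative (ln p - ln ((p + q) / 2)) + p * (1 / p - 1 / (p + q)) - q / (p + q)) (at p)"
    proof -
      have "2 / (p * 2 + q * 2) = 1 / (p + q)" "2 * q / (p * 2 + q * 2) = q / (p + q)"
        using assms by (simp_all add: divide_simps)
      then show ?thesis
        using assms by (auto intro!: derivative_eq_intros simp: mult.commute)
    qed
    ultimately show ?thesis by simp
  qed
  then show ?thesis
    by (rule has_field_derivative_transform_within_open[of _ _ _ "{0<..}"])
      (use assms eq in auto)
qed

text \<open>
  By \<open>ln_square_le_js_term\<close> the derivative of \<open>sqrt (js_term p q)\<close> in \<open>p\<close> is at most that of
  \<open>sqrt 2 * sqrt p\<close>; adding \<open>e\<^sup>2\<close> under the root removes the singularity at \<open>p = q\<close>.
\<close>

lemma sqrt_js_term_le: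
  assumes pos: "0 < p" "0 < r" "0 < q"
  shows "sqrt (js_term p q) \<le> sqrt (js_term r q) + sqrt 2 * \<bar>sqrt p - sqrt r\<bar>"
proof (rule field_le_epsilon)
  fix e :: real assume e: "0 < e"
  define \<phi> where "\<phi> s = sqrt (js_term s q + e\<^sup>2)" for s
  define \<phi>' where "\<phi>' s = ln (s / ((s + q) / 2)) / (2 * \<phi> s)" for s
  have \<phi>_pos: "0 < \<phi> s" if "0 < s" for s
    using js_term_nonneg[OF that pos(3)] e by (simp add: \<phi>_def add_nonneg_pos)
  have deriv: "(\<phi> has_real_derivative \<phi>' s) (at s)" if "0 < s" for s
    using js_term_has_derivative[OF that pos(3)] \<phi>_pos[OF that] unfolding \<phi>_def \<phi>'_def
    by (auto intro!: derivative_eq_intros simp: divide_simps)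
  have dsqrt: "((\<lambda>s. sqrt 2 * sqrt s) has_real_derivative sqrt 2 / (2 * sqrt s)) (at s)"
    if "0 < s" for s
    using that by (auto intro!: derivative_eq_intros simp: divide_simps)
  have bound: "\<bar>\<phi>' s\<bar> \<le> sqrt 2 / (2 * sqrt s)" if "0 < s" for s
  proof -
    have "s * (ln (s / ((s + q) / 2)))\<^sup>2 \<le> 2 * (js_term s q + e\<^sup>2)"
      using ln_square_le_js_term[OF that pos(3)] by (simp add: add_increasing2)
    then have "sqrt (s * (ln (s / ((s + q) / 2)))\<^sup>2) \<le> sqrt (2 * (js_term s q + e\<^sup>2))"
      by (rule real_sqrt_le_mono)
    then have "sqrt s * \<bar>ln (s / ((s + q) / 2))\<bar> \<le> sqrt 2 * \<phi> s"
      unfolding real_sqrt_mult \<phi>_def by simp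
    then show ?thesis
      using that \<phi>_pos[OF that] by (simp add: \<phi>'_def field_simps)
  qed
  \<comment> \<open>The derivative bound makes \<open>\<phi> s - sqrt 2 * sqrt s\<close>
    nonincreasing and \<open>\<phi> s + sqrt 2 * sqrt s\<close> nondecreasing; each settles one
    order of \<open>p\<close> and \<open>r\<close>.\<close>
  have "\<phi> p \<le> \<phi> r + sqrt 2 * \<bar>sqrt p - sqrt r\<bar>"
  proof (cases "r \<le> p")
    case True
    have "\<phi> p - sqrt 2 * sqrt p \<le> \<phi> r - sqrt 2 * sqrt r"
    proof (rule DERIV_nonpos_imp_nonincreasing[OF True], intro exI conjI)
      fix s assume "r \<le> s" "s \<le> p"
      then have s: "0 < s" using pos by simp
      show "((\<lambda>s. \<phi> s - sqrt 2 * sqrt s) has_real_derivative \<phi>' s - sqrt 2 / (2 * sqrt s)) (at s)"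
        by (intro DERIV_diff deriv dsqrt s)
      show "\<phi>' s - sqrt 2 / (2 * sqrt s) \<le> 0" using bound[OF s] by linarith
    qed
    then show ?thesis using True by (simp add: right_diff_distrib)
  next
    case False
    then have "p \<le> r" by simp
    then have "\<phi> p + sqrt 2 * sqrt p \<le> \<phi> r + sqrt 2 * sqrt r"
    proof (rule DERIV_nonneg_imp_nondecreasing, intro exI conjI)
      fix s assume "p \<le> s" "s \<le> r"
      then have s: "0 < s" using pos by simp
      show "((\<lambda>s. \<phi> s + sqrt 2 * sqrt s) has_real_derivative \<phi>' s + sqrt 2 / (2 * sqrt s)) (at s)"
        by (intro DERIV_add deriv dsqrt s)
      show "0 \<le> \<phi>' s + sqrt 2 / (2 * sqrt s)" using bound[OF s] by linarith
    qed
    then show ?thesis using False by (simp add: right_diff_distrib)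
  qed
  moreover have "sqrt (js_term p q) \<le> \<phi> p"
    by (simp add: \<phi>_def)
  moreover have "\<phi> r \<le> sqrt (js_term r q) + e"
    using sqrt_add_le_add_sqrt[of "js_term r q" "e\<^sup>2"] js_term_nonneg[OF pos(2,3)] e
    by (simp add: \<phi>_def)
  ultimately show "sqrt (js_term p q) \<le> sqrt (js_term r q) + sqrt 2 * \<bar>sqrt p - sqrt r\<bar> + e"
    by linarith
qed

section \<open>From pointwise estimates to divergences of densities\<close>

lemma mixture_density:
  fixes p q :: "'a \<Rightarrow> real"
  assumes [measurable]: "p \<in> borel_measurable M" "q \<in> borel_measurable M"
    and nonneg: "\<And>x. x \<in> space M \<Longrightarrow> 0 \<le> p x" "\<And>x. x \<in> space M \<Longrightarrow> 0 \<le> q x"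
  shows "mixture (density M (\<lambda>x. ennreal (p x))) (density M (\<lambda>x. ennreal (q x))) =
    density M (\<lambda>x. ennreal ((p x + q x) / 2))"
proof -
  let ?N = "density M (\<lambda>x. ennreal ((p x + q x) / 2))"
  have "(emeasure (density M (\<lambda>x. ennreal (p x))) A + emeasure (density M (\<lambda>x. ennreal (q x))) A) / 2
      = emeasure ?N A" if [measurable]: "A \<in> sets M" for A
  proof -
    have "emeasure ?N A = (\<integral>\<^sup>+ x. (ennreal (p x) * indicator A x + ennreal (q x) * indicator A x) / 2 \<partial>M)"
      by (subst emeasure_density, measurable, intro nn_integral_cong)
        (auto simp: nonneg ennreal_plus[symmetric] divide_ennreal ennreal_numeral[symmetric]
          split: split_indicator simp del: ennreal_plus ennreal_numeral)
    also have "\<dots> = (emeasure (density M (\<lambda>x. ennreal (p x))) A +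
        emeasure (density M (\<lambda>x. ennreal (q x))) A) / 2"
      by (simp add: nn_integral_divide nn_integral_add emeasure_density)
    finally show ?thesis ..
  qed
  \<comment> \<open>\<open>mixture\<close> is built by \<open>measure_of\<close>; once its set
    function agrees with the measure of \<open>?N\<close>, it is that measure.\<close>
  then have "mixture (density M (\<lambda>x. ennreal (p x))) (density M (\<lambda>x. ennreal (q x))) =
      measure_of (space ?N) (sets ?N) (emeasure ?N)"
    unfolding mixture_def using sets.sigma_sets_eq[of M] sets.space_closed[of M]
    by (simp, intro measure_of_eq) auto
  then show ?thesis
    by (simp only: measure_of_of_measure)
qed

text \<open>The ratio of \<open>p\<close> to the mean lies between \<open>exp (- \<xi>)\<close> and
  2, and \<open>ln 2 \<le> 1\<close>. This dominates the integrands of both KL terms.\<close>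

lemma ln_div_mean_bound:
  fixes p q \<xi> :: real
  assumes "0 < p" "0 < q" "0 \<le> \<xi>" "q \<le> exp \<xi> * p"
  shows "\<bar>ln (p / ((p + q) / 2))\<bar> \<le> \<xi> + 1"
proof -
  have "p / ((p + q) / 2) \<le> 2"
    using assms by (simp add: field_simps)
  then have "ln (p / ((p + q) / 2)) \<le> ln 2"
    using assms by (subst ln_le_cancel_iff) auto
  moreover have "ln 2 \<le> (1 :: real)"
    using ln_le_minus_one[of 2] by simp
  moreover have "exp (- \<xi>) \<le> p / ((p + q) / 2)"
  proof -
    have "p * 1 \<le> p * exp \<xi>"
      using assms by (intro mult_left_mono) auto
    then have "p + q \<le> 2 * (exp \<xi> * p)"
      using assms(4) by (simp add: mult.commute)
    then show ?thesis
      using assms by (simp add: exp_minus field_simps)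
  qed
  then have "- \<xi> \<le> ln (p / ((p + q) / 2))"
    using assms by (subst ln_ge_iff) auto
  ultimately show ?thesis using assms(3) by linarith
qed

text \<open>The comparability of \<open>p\<close> and \<open>q\<close> dominates both KL integrands
  by multiples of \<open>q\<close>. Their separate integrability is what permits merging the two
  integrals into one.\<close>

lemma JS_divergence_density:
  fixes p q :: "'a \<Rightarrow> real"
  assumes "sigma_finite_measure M"
    and [measurable]: "p \<in> borel_measurable M" and q: "integrable M q"
    and pos: "\<And>x. x \<in> space M \<Longrightarrow> 0 < q x" and "0 \<le> \<xi>"
    and ge: "\<And>x. x \<in> space M \<Longrightarrow> exp (- \<xi>) * q x \<le> p x"
    and le: "\<And>x. x \<in> space M \<Longrightarrow> p x \<le> exp \<xi> * q x"
  shows "integrable M (\<lambda>x. js_term (p x) (q x))"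
    and "JS_divergence (density M (\<lambda>x. ennreal (p x))) (density M (\<lambda>x. ennreal (q x))) =
      (\<integral>x. js_term (p x) (q x) \<partial>M) / 2"
proof -
  interpret sigma_finite_measure M by fact
  have [measurable]: "q \<in> borel_measurable M" using q by auto
  have ppos: "0 < p x" if "x \<in> space M" for x
    using ge[OF that] pos[OF that] by (smt (verit) exp_gt_zero mult_pos_pos)
  have qp: "q x \<le> exp \<xi> * p x" if "x \<in> space M" for x
    using ge[OF that] by (simp add: exp_minus field_simps)
  have 1: "integrable M (\<lambda>x. p x * ln (p x / ((p x + q x) / 2)))"
  proof (rule Bochner_Integration.integrable_bound)
    show "integrable M (\<lambda>x. exp \<xi> * q x * (\<xi> + 1))" using q by simp
    show "AE x in M. norm (p x * ln (p x / ((p x + q x) / 2))) \<le> norm (exp \<xi> * q x * (\<xi> + 1))"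
    proof (rule AE_I2)
      fix x assume x: "x \<in> space M"
      have "\<bar>p x\<bar> * \<bar>ln (p x / ((p x + q x) / 2))\<bar> \<le> (exp \<xi> * q x) * (\<xi> + 1)"
        using ppos[OF x] pos[OF x] qp[OF x] le[OF x] \<open>0 \<le> \<xi>\<close>
        by (intro mult_mono ln_div_mean_bound) auto
      then show "norm (p x * ln (p x / ((p x + q x) / 2))) \<le> norm (exp \<xi> * q x * (\<xi> + 1))"
        using pos[OF x] \<open>0 \<le> \<xi>\<close> by (simp add: abs_mult)
    qed
  qed measurable
  have 2: "integrable M (\<lambda>x. q x * ln (q x / ((p x + q x) / 2)))"
  proof (rule Bochner_Integration.integrable_bound)
    show "integrable M (\<lambda>x. q x * (\<xi> + 1))" using q by simp
    show "AE x in M. norm (q x * ln (q x / ((p x + q x) / 2))) \<le> norm (q x * (\<xi> + 1))"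
    proof (rule AE_I2)
      fix x assume x: "x \<in> space M"
      have "\<bar>q x\<bar> * \<bar>ln (q x / ((q x + p x) / 2))\<bar> \<le> q x * (\<xi> + 1)"
        using ppos[OF x] pos[OF x] le[OF x] \<open>0 \<le> \<xi>\<close>
        by (intro mult_mono ln_div_mean_bound) auto
      then show "norm (q x * ln (q x / ((p x + q x) / 2))) \<le> norm (q x * (\<xi> + 1))"
        using pos[OF x] \<open>0 \<le> \<xi>\<close> by (simp add: abs_mult add.commute)
    qed
  qed measurable
  from 1 2 show "integrable M (\<lambda>x. js_term (p x) (q x))"
    by (simp add: js_term_def)
  have nonneg: "\<And>x. x \<in> space M \<Longrightarrow> 0 \<le> p x" "\<And>x. x \<in> space M \<Longrightarrow> 0 \<le> q x"
    using ppos pos by (auto intro: less_imp_le)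
  have mix_pos: "(p x + q x) / 2 \<noteq> 0" if "x \<in> space M" for x
    using ppos[OF that] pos[OF that] by simp
  have "KL_divergence (exp 1) (density M (\<lambda>x. ennreal ((p x + q x) / 2))) (density M (\<lambda>x. ennreal (p x)))
      = (\<integral>x. p x * log (exp 1) (p x / ((p x + q x) / 2)) \<partial>M)"
    using nonneg mix_pos by (intro KL_density_density AE_I2) (auto intro: add_nonneg_nonneg)
  moreover have "KL_divergence (exp 1) (density M (\<lambda>x. ennreal ((p x + q x) / 2))) (density M (\<lambda>x. ennreal (q x)))
      = (\<integral>x. q x * log (exp 1) (q x / ((p x + q x) / 2)) \<partial>M)"
    using nonneg mix_pos by (intro KL_density_density AE_I2) (auto intro: add_nonneg_nonneg)
  ultimately show "JS_divergence (density M (\<lambda>x. ennreal (p x))) (density M (\<lambda>x. ennreal (q x))) =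
      (\<integral>x. js_term (p x) (q x) \<partial>M) / 2"
    using 1 2 nonneg by (simp add: JS_divergence_def mixture_density js_term_def log_def)
qed

text \<open>Pointwise, the root of \<open>js_term (p x) (q x)\<close> is at most
  \<open>s x + \<kappa> * sqrt (q x)\<close>. Minkowski's inequality, carried out by squaring,
  integrating and using Cauchy-Schwarz on the cross term, gives the claim since
  \<open>sqrt (q x)\<close> has L^2 norm 1.\<close>

lemma sqrt_JS_divergence_le:
  fixes p r q :: "'a \<Rightarrow> real"
  assumes M: "sigma_finite_measure M"
    and p [measurable]: "p \<in> borel_measurable M" and r [measurable]: "r \<in> borel_measurable M"
    and q: "integrable M q" "(\<integral>x. q x \<partial>M) = 1"
    and pos: "\<And>x. x \<in> space M \<Longrightarrow> 0 < q x" and "0 \<le> \<xi>"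
    and p_ge: "\<And>x. x \<in> space M \<Longrightarrow> exp (- \<xi>) * q x \<le> p x"
    and p_le: "\<And>x. x \<in> space M \<Longrightarrow> p x \<le> exp \<xi> * q x"
    and r_ge: "\<And>x. x \<in> space M \<Longrightarrow> exp (- \<xi>) * q x \<le> r x"
    and r_le: "\<And>x. x \<in> space M \<Longrightarrow> r x \<le> exp \<xi> * q x"
    and diff: "\<And>x. x \<in> space M \<Longrightarrow> \<bar>p x - r x\<bar> \<le> \<delta> * q x" and "0 \<le> \<delta>"
  shows "sqrt (JS_divergence (density M (\<lambda>x. ennreal (p x))) (density M (\<lambda>x. ennreal (q x)))) \<le>
    sqrt (JS_divergence (density M (\<lambda>x. ennreal (r x))) (density M (\<lambda>x. ennreal (q x)))) +
    \<delta> * exp (\<xi> / 2) / 2"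
proof -
  have [measurable]: "q \<in> borel_measurable M" using q by auto
  have ppos: "0 < p x" and rpos: "0 < r x" if "x \<in> space M" for x
    using p_ge[OF that] r_ge[OF that] pos[OF that] by (smt (verit) exp_gt_zero mult_pos_pos)+
  have P: "integrable M (\<lambda>x. js_term (p x) (q x))"
    "JS_divergence (density M (\<lambda>x. ennreal (p x))) (density M (\<lambda>x. ennreal (q x))) =
      (\<integral>x. js_term (p x) (q x) \<partial>M) / 2"
    using JS_divergence_density[OF M p q(1) pos \<open>0 \<le> \<xi>\<close> p_ge p_le] by blast+
  have R: "integrable M (\<lambda>x. js_term (r x) (q x))"
    "JS_divergence (density M (\<lambda>x. ennreal (r x))) (density M (\<lambda>x. ennreal (q x))) =
      (\<integral>x. js_term (r x) (q x) \<partial>M) / 2"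
    using JS_divergence_density[OF M r q(1) pos \<open>0 \<le> \<xi>\<close> r_ge r_le] by blast+
  \<comment> \<open>The factor \<open>sqrt 2\<close> is the Lipschitz constant from
    \<open>sqrt_js_term_le\<close>; it cancels at the end because JS is half the integral.\<close>
  define \<kappa> where "\<kappa> = sqrt 2 * (\<delta> * exp (\<xi> / 2) / 2)"
  define s where "s x = sqrt (js_term (r x) (q x))" for x
  have \<kappa>: "0 \<le> \<kappa>" using \<open>0 \<le> \<delta>\<close> by (simp add: \<kappa>_def)
  have s_nonneg: "0 \<le> s x" and s2: "(s x)\<^sup>2 = js_term (r x) (q x)" if "x \<in> space M" for x
    using js_term_nonneg[OF rpos[OF that] pos[OF that]] by (simp_all add: s_def)
  have [measurable]: "s \<in> borel_measurable M"
    unfolding s_def js_term_def by measurable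
  have s2_int: "integrable M (\<lambda>x. (s x)\<^sup>2)"
    using R(1) by (simp add: s2 cong: Bochner_Integration.integrable_cong)
  have q2_int: "integrable M (\<lambda>x. (sqrt (q x))\<^sup>2)"
    using q pos by (simp add: less_imp_le cong: Bochner_Integration.integrable_cong)
  have q2: "(\<integral>x. (sqrt (q x))\<^sup>2 \<partial>M) = 1"
    using q pos by (simp add: less_imp_le cong: Bochner_Integration.integral_cong)
  define A where "A = (\<integral>x. (s x)\<^sup>2 \<partial>M)"
  have A: "0 \<le> A" by (simp add: A_def)
  have CS: "integrable M (\<lambda>x. s x * sqrt (q x))" "(\<integral>x. s x * sqrt (q x) \<partial>M) \<le> sqrt A"
  proof -
    show "integrable M (\<lambda>x. s x * sqrt (q x))"
      by (intro Cauchy_Schwarz_integral(1) s2_int q2_int) measurable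
    have "(\<integral>x. s x * sqrt (q x) \<partial>M) \<le> (\<integral>x. \<bar>s x * sqrt (q x)\<bar> \<partial>M)"
      using integral_abs_bound[of M "\<lambda>x. s x * sqrt (q x)"] by linarith
    also have "\<dots> \<le> sqrt A * sqrt 1"
      unfolding A_def q2[symmetric] by (intro Cauchy_Schwarz_integral(2) s2_int q2_int) measurable
    finally show "(\<integral>x. s x * sqrt (q x) \<partial>M) \<le> sqrt A" by simp
  qed
  have point: "js_term (p x) (q x) \<le> (s x)\<^sup>2 + 2 * \<kappa> * (s x * sqrt (q x)) + \<kappa>\<^sup>2 * q x"
    if x: "x \<in> space M" for x
  proof -
    \<comment> \<open>Bounds the sum of the roots of \<open>p x\<close> and \<open>r x\<close> from
      below; dividing \<open>\<bar>p x - r x\<bar>\<close> by that sum yields the difference of the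
      roots.\<close>
    have low: "exp (- (\<xi> / 2)) * sqrt (q x) \<le> sqrt y" if "exp (- \<xi>) * q x \<le> y" for y
    proof -
      have "exp (- (\<xi> / 2)) = sqrt (exp (- \<xi>))"
        by (rule real_sqrt_unique[symmetric]) (simp_all add: power2_eq_square exp_add[symmetric])
      then show ?thesis
        using real_sqrt_le_mono[OF that] by (simp add: real_sqrt_mult)
    qed
    have "\<bar>sqrt (p x) - sqrt (r x)\<bar> * (2 * (exp (- (\<xi> / 2)) * sqrt (q x))) \<le>
        \<bar>sqrt (p x) - sqrt (r x)\<bar> * (sqrt (p x) + sqrt (r x))"
      using low[OF p_ge[OF x]] low[OF r_ge[OF x]] by (intro mult_left_mono) auto
    also have "\<dots> = \<bar>(sqrt (p x) - sqrt (r x)) * (sqrt (p x) + sqrt (r x))\<bar>"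
      using ppos[OF x] rpos[OF x] by (simp add: abs_mult)
    also have "\<dots> = \<bar>p x - r x\<bar>"
      using ppos[OF x] rpos[OF x] by (simp add: algebra_simps)
    also have "\<dots> \<le> \<delta> * (sqrt (q x) * sqrt (q x))"
      using diff[OF x] pos[OF x] by simp
    finally have "\<bar>sqrt (p x) - sqrt (r x)\<bar> * (2 * exp (- (\<xi> / 2))) * sqrt (q x) \<le>
        \<delta> * sqrt (q x) * sqrt (q x)" by (simp add: mult_ac)
    then have "\<bar>sqrt (p x) - sqrt (r x)\<bar> * (2 * exp (- (\<xi> / 2))) \<le> \<delta> * sqrt (q x)"
      using pos[OF x] by (simp only: mult_le_cancel_right_pos real_sqrt_gt_zero)
    then have "\<bar>sqrt (p x) - sqrt (r x)\<bar> \<le> \<delta> * exp (\<xi> / 2) / 2 * sqrt (q x)"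
      by (simp add: exp_minus field_simps)
    then have "sqrt 2 * \<bar>sqrt (p x) - sqrt (r x)\<bar> \<le> \<kappa> * sqrt (q x)"
      unfolding \<kappa>_def mult.assoc by (rule mult_left_mono) simp
    then have "sqrt (js_term (p x) (q x)) \<le> s x + \<kappa> * sqrt (q x)"
      using sqrt_js_term_le[OF ppos[OF x] rpos[OF x] pos[OF x]] by (simp add: s_def)
    then have "js_term (p x) (q x) \<le> (s x + \<kappa> * sqrt (q x))\<^sup>2"
      by (rule sqrt_le_D)
    also have "\<dots> = (s x)\<^sup>2 + 2 * \<kappa> * (s x * sqrt (q x)) + \<kappa>\<^sup>2 * q x"
      using pos[OF x] by (simp add: power2_sum power_mult_distrib)
    finally show ?thesis .
  qed
  have "(\<integral>x. js_term (p x) (q x) \<partial>M) \<le> (\<integral>x. (s x)\<^sup>2 + 2 * \<kappa> * (s x * sqrt (q x)) + \<kappa>\<^sup>2 * q x \<partial>M)"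
    using s2_int CS(1) q(1) by (intro integral_mono P(1) point) auto
  also have "\<dots> = A + 2 * \<kappa> * (\<integral>x. s x * sqrt (q x) \<partial>M) + \<kappa>\<^sup>2"
    using s2_int CS(1) q by (simp add: A_def)
  also have "\<dots> \<le> (sqrt A + \<kappa>)\<^sup>2"
    using mult_left_mono[OF CS(2), of "2 * \<kappa>"] \<kappa> A by (simp add: power2_sum algebra_simps)
  finally have "sqrt (\<integral>x. js_term (p x) (q x) \<partial>M) \<le> sqrt A + \<kappa>"
    using \<kappa> A by (intro real_le_lsqrt) auto
  moreover have "A = (\<integral>x. js_term (r x) (q x) \<partial>M)"
    unfolding A_def by (rule Bochner_Integration.integral_cong) (simp_all add: s2)
  ultimately have "sqrt (\<integral>x. js_term (p x) (q x) \<partial>M) / sqrt 2 \<le>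
      (sqrt (\<integral>x. js_term (r x) (q x) \<partial>M) + \<kappa>) / sqrt 2"
    by (intro divide_right_mono) auto
  then show ?thesis
    unfolding P(2) R(2) real_sqrt_divide add_divide_distrib by (simp add: \<kappa>_def)
qed

section \<open>Utility and privacy of a single client\<close>

lemma client_utility_bounds:
  fixes X :: "'s \<Rightarrow> 'z multiset"
  assumes "prob_space \<Omega>" "0 \<le> c"
    and U: "\<And>\<omega> d. \<omega> \<in> space \<Omega> \<Longrightarrow> d \<in># X \<omega> \<Longrightarrow> 0 \<le> U w d"
      "\<And>\<omega> d. \<omega> \<in> space \<Omega> \<Longrightarrow> d \<in># X \<omega> \<Longrightarrow> U w d \<le> c"
  shows "0 \<le> client_utility \<Omega> X U w" "client_utility \<Omega> X U w \<le> c"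
proof -
  interpret prob_space \<Omega> by fact
  let ?f = "\<lambda>\<omega>. 1 / real (size (X \<omega>)) * (\<Sum>d\<in>#X \<omega>. U w d)"
  have "0 \<le> (\<Sum>d\<in>#X \<omega>. U w d)" if "\<omega> \<in> space \<Omega>" for \<omega>
    using sum_mset_mono[of "X \<omega>" "\<lambda>_. 0" "U w"] U(1)[OF that] by simp
  then have "0 \<le> ?f \<omega>" if "\<omega> \<in> space \<Omega>" for \<omega>
    using that by (intro mult_nonneg_nonneg) auto
  then show "0 \<le> client_utility \<Omega> X U w"
    unfolding client_utility_def by (intro Bochner_Integration.integral_nonneg)
  have f_le: "?f \<omega> \<le> c" if "\<omega> \<in> space \<Omega>" for \<omega>
  proof -
    have "(\<Sum>d\<in>#X \<omega>. U w d) \<le> (\<Sum>d\<in>#X \<omega>. c)"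
      using U(2)[OF that] by (intro sum_mset_mono) auto
    \<comment> \<open>For an empty data set the average is 0, since division by zero gives
      0.\<close>
    then show ?thesis
      using \<open>0 \<le> c\<close> by (cases "X \<omega> = {#}") (auto simp: pos_divide_le_eq nonempty_has_size[symmetric] mult.commute)
  qed
  show "client_utility \<Omega> X U w \<le> c"
  proof (cases "integrable \<Omega> ?f")
    case True
    then show ?thesis
      unfolding client_utility_def by (rule integral_le_const) (rule AE_I2, rule f_le)
  next
    case False
    \<comment> \<open>The integral of a non-integrable function is 0 by convention, which
      \<open>c\<close> still bounds.\<close>
    then show ?thesis
      using \<open>0 \<le> c\<close> by (simp only: client_utility_def not_integrable_integral_eq[OF False])
  qed
qed

lemma client_utility_dist_diff_le:
  fixes U :: "real ^ 'n \<Rightarrow> 'z \<Rightarrow> real"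
  assumes "prob_space \<Omega>" "diagonal_covariance S1" "diagonal_covariance S2" "0 \<le> B"
    and U: "\<And>w \<omega> d. \<omega> \<in> space \<Omega> \<Longrightarrow> d \<in># X \<omega> \<Longrightarrow> 0 \<le> U w d"
      "\<And>w \<omega> d. \<omega> \<in> space \<Omega> \<Longrightarrow> d \<in># X \<omega> \<Longrightarrow> sqrt 2 * U w d \<le> B"
  shows "client_utility_dist \<Omega> X U (mv_normal \<mu>1 S1) - client_utility_dist \<Omega> X U (mv_normal \<mu>2 S2)
    \<le> B * h_dist \<mu>1 S1 \<mu>2 S2"
proof (cases "client_utility \<Omega> X U \<in> borel_measurable borel")
  case True
  have "0 \<le> B / sqrt 2" using \<open>0 \<le> B\<close> by simp
  moreover have "U w d \<le> B / sqrt 2" if "\<omega> \<in> space \<Omega>" "d \<in># X \<omega>" for w \<omega> d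
    using U(2)[OF that] by (simp add: field_simps)
  \<comment> \<open>The range has width \<open>B / sqrt 2\<close>, which absorbs the
    \<open>sqrt 2\<close> of the total variation bound.\<close>
  ultimately have "0 \<le> client_utility \<Omega> X U w" "client_utility \<Omega> X U w \<le> B / sqrt 2" for w
    using client_utility_bounds[OF assms(1), of "B / sqrt 2" X U w] U(1) by blast+
  from integral_mv_normal_diff_le[OF assms(2,3) True this, of \<mu>1 \<mu>2, THEN abs_le_D1]
  show ?thesis by (simp add: client_utility_dist_def)
next
  case False
  \<comment> \<open>Without measurability both expectations take the default value 0, and the
    right-hand side is nonnegative.\<close>
  then have "\<not> integrable (mv_normal \<mu> S) (client_utility \<Omega> X U)" for \<mu> S
    using borel_measurable_integrable measurable_cong_sets[OF sets_mv_normal refl] by blast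
  then show ?thesis
    using \<open>0 \<le> B\<close> h_dist_nonneg[OF assms(2,3)]
    by (simp add: client_utility_dist_def not_integrable_integral_eq)
qed

text \<open>
  All posterior densities lie between \<open>e\<^sup>-\<^sup>\<xi>\<close> and \<open>e\<^sup>\<xi>\<close> times the prior, so the beliefs under
  two Gaussians differ by at most \<open>(e\<^sup>\<xi> - e\<^sup>-\<^sup>\<xi>) sqrt 2 h\<close> times the prior.
\<close>

lemma sqrt_JS_posterior_belief_le:
  fixes post :: "'d \<Rightarrow> real ^ 'n \<Rightarrow> real"
  assumes \<nu>: "sigma_finite_measure \<nu>"
    and prior [measurable]: "prior \<in> borel_measurable \<nu>"
    and prior_pos: "\<And>d. d \<in> space \<nu> \<Longrightarrow> 0 < prior d"
    and prior_int: "(\<integral>\<^sup>+ d. ennreal (prior d) \<partial>\<nu>) = 1"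
    and post: "(\<lambda>(d, w). post d w) \<in> borel_measurable (\<nu> \<Otimes>\<^sub>M borel)"
    and post_pos: "\<And>d w. d \<in> space \<nu> \<Longrightarrow> 0 < post d w"
    and \<xi>: "\<And>d w. d \<in> space \<nu> \<Longrightarrow> \<bar>ln (post d w / prior d)\<bar> \<le> \<xi>" "0 \<le> \<xi>"
    and S: "diagonal_covariance S1" "diagonal_covariance S2"
  shows "sqrt (JS_divergence (posterior_belief \<nu> post UNIV (mv_normal \<mu>1 S1)) (prior_belief \<nu> prior))
    \<le> sqrt (JS_divergence (posterior_belief \<nu> post UNIV (mv_normal \<mu>2 S2)) (prior_belief \<nu> prior))
      + sqrt 2 * (exp (2 * \<xi>) - 1) / 2 * h_dist \<mu>1 S1 \<mu>2 S2"
proof -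
  define F where "F \<mu> S d = (\<integral>w. post d w \<partial>mv_normal \<mu> S)" for \<mu> S d
  have belief: "posterior_belief \<nu> post UNIV (mv_normal \<mu> S) = density \<nu> (\<lambda>d. ennreal (F \<mu> S d))" for \<mu> S
    by (simp add: posterior_belief_def F_def set_lebesgue_integral_def)
  have post_bounds: "exp (- \<xi>) * prior d \<le> post d w" "post d w \<le> exp \<xi> * prior d"
    if d: "d \<in> space \<nu>" for d w
  proof -
    have pos: "0 < post d w / prior d"
      using post_pos[OF d] prior_pos[OF d] by simp
    have "- \<xi> \<le> ln (post d w / prior d)" "ln (post d w / prior d) \<le> \<xi>"
      using \<xi>(1)[OF d, of w] by auto
    then have "exp (- \<xi>) \<le> post d w / prior d" "post d w / prior d \<le> exp \<xi>"
      using pos by (metis exp_le_cancel_iff exp_ln)+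
    then show "exp (- \<xi>) * prior d \<le> post d w" "post d w \<le> exp \<xi> * prior d"
      using prior_pos[OF d] by (simp_all add: field_simps)
  qed
  have post_d: "post d \<in> borel_measurable borel" if "d \<in> space \<nu>" for d
    using measurable_compose[OF measurable_Pair1'[OF that] post] by simp
  have F_bounds: "exp (- \<xi>) * prior d \<le> F \<mu> S d" "F \<mu> S d \<le> exp \<xi> * prior d"
    if d: "d \<in> space \<nu>" and S: "diagonal_covariance S" for d \<mu> S
  proof -
    interpret prob_space "mv_normal \<mu> S"
      using S by (rule prob_space_mv_normal)
    have "integrable (mv_normal \<mu> S) (post d)"
    proof (rule integrable_const_bound)
      show "AE w in mv_normal \<mu> S. norm (post d w) \<le> exp \<xi> * prior d"
        using post_bounds(2)[OF d] post_pos[OF d] by (intro AE_I2) (simp add: abs_of_pos)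
      show "post d \<in> borel_measurable (mv_normal \<mu> S)"
        using post_d[OF d] by measurable
    qed
    then show "exp (- \<xi>) * prior d \<le> F \<mu> S d" "F \<mu> S d \<le> exp \<xi> * prior d"
      unfolding F_def using post_bounds[OF d]
      by (auto intro!: integral_ge_const integral_le_const)
  qed
  have F_meas: "F \<mu> S \<in> borel_measurable \<nu>" if "diagonal_covariance S" for \<mu> S
  proof -
    interpret prob_space "mv_normal \<mu> S"
      using that by (rule prob_space_mv_normal)
    have "(\<lambda>(d, w). post d w) \<in> borel_measurable (\<nu> \<Otimes>\<^sub>M mv_normal \<mu> S)"
      using post by (simp cong: measurable_cong_sets sets_pair_measure_cong add: sets_mv_normal)
    then show ?thesis
      unfolding F_def by (rule borel_measurable_lebesgue_integral)
  qed
  define \<delta> where "\<delta> = (exp \<xi> - exp (- \<xi>)) * (sqrt 2 * h_dist \<mu>1 S1 \<mu>2 S2)"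
  have h: "0 \<le> h_dist \<mu>1 S1 \<mu>2 S2" using S by (rule h_dist_nonneg)
  have \<delta>: "0 \<le> \<delta>"
    using \<open>0 \<le> \<xi>\<close> h by (simp add: \<delta>_def)
  have diff: "\<bar>F \<mu>1 S1 d - F \<mu>2 S2 d\<bar> \<le> \<delta> * prior d" if "d \<in> space \<nu>" for d
    using integral_mv_normal_diff_le[OF S post_d[OF that] post_bounds[OF that], of \<mu>1 \<mu>2]
    by (simp add: F_def \<delta>_def left_diff_distrib algebra_simps)
  have prior1: "integrable \<nu> prior"
    using prior_pos prior_int by (intro integrableI_nonneg) (auto intro: less_imp_le)
  have prior2: "(\<integral>d. prior d \<partial>\<nu>) = 1"
    using prior_pos prior_int by (subst integral_eq_nn_integral) (auto intro: less_imp_le)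
  have "sqrt (JS_divergence (posterior_belief \<nu> post UNIV (mv_normal \<mu>1 S1)) (prior_belief \<nu> prior))
    \<le> sqrt (JS_divergence (posterior_belief \<nu> post UNIV (mv_normal \<mu>2 S2)) (prior_belief \<nu> prior))
      + \<delta> * exp (\<xi> / 2) / 2"
    unfolding belief prior_belief_def
    by (rule sqrt_JS_divergence_le[OF \<nu> F_meas F_meas prior1 prior2 prior_pos \<open>0 \<le> \<xi>\<close>])
      (use S F_bounds diff \<delta> in auto)
  \<comment> \<open>Weakening \<open>exp (\<xi> / 2)\<close> to \<open>exp \<xi>\<close> turns the
    product with \<open>exp \<xi> - exp (- \<xi>)\<close> into
    \<open>exp (2 * \<xi>) - 1\<close>.\<close>
  moreover have "\<delta> * exp (\<xi> / 2) / 2 \<le> sqrt 2 * (exp (2 * \<xi>) - 1) / 2 * h_dist \<mu>1 S1 \<mu>2 S2"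
  proof -
    have "(exp \<xi> - exp (- \<xi>)) * exp (\<xi> / 2) \<le> (exp \<xi> - exp (- \<xi>)) * exp \<xi>"
      using \<open>0 \<le> \<xi>\<close> by (intro mult_left_mono) auto
    also have "\<dots> = exp (2 * \<xi>) - 1"
      by (simp add: left_diff_distrib exp_add[symmetric])
    finally have "(exp \<xi> - exp (- \<xi>)) * exp (\<xi> / 2) * (sqrt 2 * h_dist \<mu>1 S1 \<mu>2 S2 / 2) \<le>
        (exp (2 * \<xi>) - 1) * (sqrt 2 * h_dist \<mu>1 S1 \<mu>2 S2 / 2)"
      using h by (intro mult_right_mono) auto
    then show ?thesis
      by (simp add: \<delta>_def mult_ac)
  qed
  ultimately show ?thesis by linarith
qed

section \<open>Averaging over the clients and the combined bounds\<close>

lemma average_le: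
  fixes a b :: "nat \<Rightarrow> real"
  assumes "1 \<le> K" "\<And>k. k \<in> {1..K} \<Longrightarrow> a k \<le> b k + c"
  shows "(1 / real K) * (\<Sum>k = 1..K. a k) \<le> (1 / real K) * (\<Sum>k = 1..K. b k) + c"
proof -
  have "(\<Sum>k = 1..K. a k) \<le> (\<Sum>k = 1..K. b k + c)"
    using assms(2) by (rule sum_mono)
  then show ?thesis
    using assms(1) by (simp add: sum.distrib field_simps)
qed

text \<open>The utility loss compares averaged Gaussians, whose covariances are divided by
  \<open>K\<close>. Hence an arbitrary admissible \<open>B\<close> comes with the scaled
  \<open>h_dist\<close>, while \<open>C\<close> absorbs the factor \<open>sqrt K\<close> lost in
  returning to the original covariances. Quantifying \<open>C\<close> before the Gaussian parameters
  makes it uniform in them.\<close>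

theorem theorem4p4:
  fixes K :: nat
    and \<nu> :: "nat \<Rightarrow> 'z multiset measure"
    and \<Omega> :: "'s measure"
    and X :: "nat \<Rightarrow> 's \<Rightarrow> 'z multiset"
    and prior :: "nat \<Rightarrow> 'z multiset \<Rightarrow> real"
    and post :: "nat \<Rightarrow> 'z multiset \<Rightarrow> real ^ ('m::finite + 'o::finite) \<Rightarrow> real"
    and U :: "real ^ ('m + 'o) \<Rightarrow> 'z \<Rightarrow> real"
  assumes K: "1 \<le> K"
    and prob: "prob_space \<Omega>"
    and data: "\<And>k. k \<in> {1..K} \<Longrightarrow> X k \<in> measurable \<Omega> (\<nu> k)"
    and nonempty: "\<And>k. k \<in> {1..K} \<Longrightarrow> {#} \<notin> space (\<nu> k)"
    and U_nonneg: "\<And>k w D d. k \<in> {1..K} \<Longrightarrow> D \<in> space (\<nu> k) \<Longrightarrow> d \<in># D \<Longrightarrow> 0 \<le> U w d"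
    and U_bounded: "\<exists>B. utility_constant K \<nu> (\<lambda>k. UNIV) U B"
  shows "\<exists>C. \<forall>(\<mu>u :: real ^ 'm) (\<mu>o :: real ^ 'o) (\<mu>g :: real ^ 'o) \<Sigma>u \<Sigma>o \<Sigma>g.
    diagonal_covariance \<Sigma>u \<and> diagonal_covariance \<Sigma>o \<and> diagonal_covariance \<Sigma>g \<longrightarrow>
    (let \<mu>0 = vec_append \<mu>u \<mu>o; \<Sigma>0 = block_diag \<Sigma>u \<Sigma>o;
         \<mu> = vec_append \<mu>u \<mu>g; \<Sigma> = block_diag \<Sigma>u \<Sigma>g;
         PO = (\<lambda>k. mv_normal \<mu>0 \<Sigma>0); PS = (\<lambda>k. mv_normal \<mu> \<Sigma>);
         PaO = mv_normal \<mu>0 ((1 / real K) *\<^sub>R \<Sigma>0); PaS = mv_normal \<mu> ((1 / real K) *\<^sub>R \<Sigma>);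
         W = model_space PO PS;
         \<epsilon>p = avg_leakage K \<nu> W prior post PS;
         \<epsilon>u = utility_loss K \<Omega> X U PaO PaS;
         C1 = avg_leakage K \<nu> W prior post PO;
         C3 = sqrt 2 * (exp (2 * xi K \<nu> W prior post) - 1) / 2
     in adversary_beliefs K \<nu> W prior post \<longrightarrow>
          C1 \<le> \<epsilon>p + C3 * h_dist \<mu>o \<Sigma>o \<mu>g \<Sigma>g \<and>
          utility_constant K \<nu> W U C \<and>
          \<epsilon>u \<le> C * h_dist \<mu>o \<Sigma>o \<mu>g \<Sigma>g \<and>
          (\<forall>B. utility_constant K \<nu> W U B \<longrightarrow>
             \<epsilon>u \<le> B * h_dist \<mu>o ((1 / real K) *\<^sub>R \<Sigma>o) \<mu>g ((1 / real K) *\<^sub>R \<Sigma>g)))"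
proof -
  obtain B0 where B0: "utility_constant K \<nu> (\<lambda>k. UNIV) U B0"
    using U_bounded by blast
  interpret \<Omega>: prob_space \<Omega> by (rule prob)
  have X_space: "X k \<omega> \<in> space (\<nu> k)" if "k \<in> {1..K}" "\<omega> \<in> space \<Omega>" for k \<omega>
    using measurable_space[OF data[OF that(1)] that(2)] .
  have ex_data: "\<exists>D. D \<in> space (\<nu> k)" if "k \<in> {1..K}" for k
    using X_space[OF that] \<Omega>.not_empty by blast
  have one: "1 \<in> {1..K}" using K by simp
  \<comment> \<open>Client 1 exists and has a nonempty data set, so \<open>B\<close> bounds
    \<open>sqrt 2\<close> times some nonnegative utility.\<close>
  have B_nonneg: "0 \<le> B" if B: "utility_constant K \<nu> (\<lambda>k. UNIV) U B" for B
  proof -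
    obtain D where D: "D \<in> space (\<nu> 1)" using ex_data[OF one] ..
    moreover obtain d where d: "d \<in># D" using nonempty[OF one] D by (metis multiset_nonemptyE)
    ultimately have "sqrt 2 * U 0 d \<le> B"
      using B one unfolding utility_constant_def by blast
    moreover have "0 \<le> sqrt 2 * U 0 d"
      using U_nonneg[OF one D d] by simp
    ultimately show ?thesis by linarith
  qed
  \<comment> \<open>The factor \<open>sqrt (real K)\<close> pays for
    \<open>h_dist_scaled_le\<close>. It is at least 1 and \<open>B0\<close> is nonnegative, so
    \<open>C\<close> is still admissible.\<close>
  define C where "C = sqrt (real K) * B0"
  have "1 * B0 \<le> C"
    unfolding C_def using K B_nonneg[OF B0] by (intro mult_right_mono) auto
  then have C_const: "utility_constant K \<nu> (\<lambda>k. UNIV) U C"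
    using B0 unfolding utility_constant_def mult_1 by (meson order_trans)
  show ?thesis
  proof (intro exI[of _ C] allI impI, unfold Let_def, intro impI, elim conjE)
    fix \<mu>u :: "real ^ 'm" and \<mu>o \<mu>g :: "real ^ 'o"
      and \<Sigma>u :: "real ^ 'm ^ 'm" and \<Sigma>o \<Sigma>g :: "real ^ 'o ^ 'o"
    assume S: "diagonal_covariance \<Sigma>u" "diagonal_covariance \<Sigma>o" "diagonal_covariance \<Sigma>g"
    let ?\<mu>O = "vec_append \<mu>u \<mu>o" and ?\<mu> = "vec_append \<mu>u \<mu>g"
    let ?\<Sigma>O = "block_diag \<Sigma>u \<Sigma>o" and ?\<Sigma> = "block_diag \<Sigma>u \<Sigma>g"
    let ?W = "model_space (\<lambda>k. mv_normal ?\<mu>O ?\<Sigma>O) (\<lambda>k. mv_normal ?\<mu> ?\<Sigma>)"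
    let ?h = "h_dist \<mu>o \<Sigma>o \<mu>g \<Sigma>g"
    let ?hK = "h_dist \<mu>o ((1 / real K) *\<^sub>R \<Sigma>o) \<mu>g ((1 / real K) *\<^sub>R \<Sigma>g)"
    let ?PaO = "mv_normal ?\<mu>O ((1 / real K) *\<^sub>R ?\<Sigma>O)"
    let ?PaS = "mv_normal ?\<mu> ((1 / real K) *\<^sub>R ?\<Sigma>)"
    have Kpos: "0 < 1 / real K" using K by simp
    have S0: "diagonal_covariance ?\<Sigma>O" and S1: "diagonal_covariance ?\<Sigma>"
      using S by (auto intro: diagonal_covariance_block_diag)
    \<comment> \<open>Gaussians have full support, so the model space, and with it \<open>xi\<close>
      and admissibility of utility constants, is the same for all parameters.\<close>
    have W: "?W = (\<lambda>k. UNIV)"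
      by (rule ext) (rule model_space_mv_normal[OF S0])
    have h: "h_dist ?\<mu>O ?\<Sigma>O ?\<mu> ?\<Sigma> = ?h"
      by (rule h_dist_block[OF S])
    have hK: "h_dist ?\<mu>O ((1 / real K) *\<^sub>R ?\<Sigma>O) ?\<mu> ((1 / real K) *\<^sub>R ?\<Sigma>) = ?hK"
      unfolding block_diag_scaleR
      by (intro h_dist_block diagonal_covariance_scaleR S Kpos)
    have loss: "utility_loss K \<Omega> X U ?PaO ?PaS \<le> B * ?hK"
      if B: "utility_constant K \<nu> (\<lambda>k. UNIV) U B" for B
    proof -
      have "client_utility_dist \<Omega> (X k) U ?PaO - client_utility_dist \<Omega> (X k) U ?PaS \<le> B * ?hK"
        if k: "k \<in> {1..K}" for k
        unfolding hK[symmetric]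
      proof (intro client_utility_dist_diff_le prob B_nonneg[OF B] diagonal_covariance_scaleR S0 S1 Kpos)
        fix w \<omega> d assume \<omega>: "\<omega> \<in> space \<Omega>" and d: "d \<in># X k \<omega>"
        show "0 \<le> U w d" using U_nonneg[OF k X_space[OF k \<omega>] d] .
        show "sqrt 2 * U w d \<le> B"
          using B k X_space[OF k \<omega>] d unfolding utility_constant_def by blast
      qed
      then show ?thesis
        unfolding utility_loss_def using average_le[OF K, where b = "\<lambda>_. 0"] by simp
    qed
    have loss_C: "utility_loss K \<Omega> X U ?PaO ?PaS \<le> C * ?h"
    proof -
      have "utility_loss K \<Omega> X U ?PaO ?PaS \<le> B0 * ?hK"
        by (rule loss[OF B0])
      also have "\<dots> \<le> B0 * (sqrt (real K) * ?h)"
        using B_nonneg[OF B0] by (intro mult_left_mono h_dist_scaled_le S K)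
      finally show ?thesis by (simp add: C_def mult_ac)
    qed
    assume "adversary_beliefs K \<nu> ?W prior post"
    then have adv: "adversary_beliefs K \<nu> (\<lambda>k. UNIV) prior post"
      unfolding W .
    define \<xi> where "\<xi> = xi K \<nu> (\<lambda>k. UNIV) prior post"
    \<comment> \<open>The boundedness contained in \<open>adversary_beliefs\<close> makes the
      supremum a genuine upper bound.\<close>
    have \<xi>: "\<bar>ln (post k d w / prior k d)\<bar> \<le> \<xi>" if "k \<in> {1..K}" "d \<in> space (\<nu> k)" for k d w
      unfolding \<xi>_def xi_def
      using adv that by (intro cSup_upper) (auto simp: adversary_beliefs_def log_ratios_def)
    have \<xi>_nonneg: "0 \<le> \<xi>"
    proof -
      obtain D where "D \<in> space (\<nu> 1)" using ex_data[OF one] ..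
      from \<xi>[OF one this, of 0] show ?thesis by linarith
    qed
    have leak: "avg_leakage K \<nu> (\<lambda>k. UNIV) prior post (\<lambda>k. mv_normal ?\<mu>O ?\<Sigma>O) \<le>
        avg_leakage K \<nu> (\<lambda>k. UNIV) prior post (\<lambda>k. mv_normal ?\<mu> ?\<Sigma>) +
        sqrt 2 * (exp (2 * \<xi>) - 1) / 2 * ?h"
      unfolding avg_leakage_def h[symmetric]
    proof (rule average_le[OF K])
      fix k assume k: "k \<in> {1..K}"
      have "sets (restrict_space borel (UNIV :: (real ^ ('m + 'o)) set)) = sets borel"
        by (simp add: sets_restrict_space)
      then have post: "(\<lambda>(d, w). post k d w) \<in> borel_measurable (\<nu> k \<Otimes>\<^sub>M borel)"
        using adv k measurable_cong_sets[OF sets_pair_measure_cong[OF refl] refl]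
        unfolding adversary_beliefs_def by blast
      show "sqrt (JS_divergence (posterior_belief (\<nu> k) (post k) UNIV (mv_normal ?\<mu>O ?\<Sigma>O))
          (prior_belief (\<nu> k) (prior k))) \<le>
        sqrt (JS_divergence (posterior_belief (\<nu> k) (post k) UNIV (mv_normal ?\<mu> ?\<Sigma>))
          (prior_belief (\<nu> k) (prior k))) +
        sqrt 2 * (exp (2 * \<xi>) - 1) / 2 * h_dist ?\<mu>O ?\<Sigma>O ?\<mu> ?\<Sigma>"
        using adv k \<xi>[OF k]
        by (intro sqrt_JS_posterior_belief_le post \<xi>_nonneg S0 S1)
          (auto simp: adversary_beliefs_def)
    qed
    show "avg_leakage K \<nu> ?W prior post (\<lambda>k. mv_normal ?\<mu>O ?\<Sigma>O) \<le>
        avg_leakage K \<nu> ?W prior post (\<lambda>k. mv_normal ?\<mu> ?\<Sigma>) +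
          sqrt 2 * (exp (2 * xi K \<nu> ?W prior post) - 1) / 2 * ?h \<and>
        utility_constant K \<nu> ?W U C \<and>
        utility_loss K \<Omega> X U ?PaO ?PaS \<le> C * ?h \<and>
        (\<forall>B. utility_constant K \<nu> ?W U B \<longrightarrow> utility_loss K \<Omega> X U ?PaO ?PaS \<le> B * ?hK)"
      unfolding W using leak C_const loss_C loss by (auto simp: \<xi>_def)
  qed
qed

end
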